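(* Let $T$ be a completely non unitary contraction on a separable complex Hilbert space $\mathcal{H}$ whose characteristic function $\Theta_T$ is a polynomial of degree $n$, and let $$\begin{bmatrix}S&*&*\\0&N&*\\0&0&C\end{bmatrix}\quad\text{and}\quad\begin{bmatrix}S_*&*&*\\0&N_*&*\\0&0&C_*\end{bmatrix}$$ be the canonical and the $*$-canonical matrix representations of $T$ on $\mathcal{H}=\mathcal{H}_1\oplus\mathcal{H}_0\oplus\mathcal{H}_{-1}$ and on $\mathcal{H}=\mathcal{H}_{1*}\oplus\mathcal{H}_{0*}\oplus\mathcal{H}_{-1*}$, respectively. Let moreover $$T=\begin{bmatrix}S'&*&*\\0&N'&*\\0&0&C'\end{bmatrix}$$ be another representation of $T$ on $\mathcal{H}=\mathcal{H}'_1\oplus\mathcal{H}'_0\oplus\mathcal{H}'_{-1}$, where $S'$ is a pure shift on $\mathcal{H}'_1$, $N'$ is a nilpotent operator of order $n$ on $\mathcal{H}'_0$ and $C'$ is a pure co-shift on $\mathcal{H}'_{-1}$. Then the pure shifts $S$, $S'$ and $S_*$ are unitarily equivalent, and the pure co-shifts $C$, $C'$ and $C_*$ are unitarily equivalent.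
   Context: A contraction $T$ is completely non unitary if there is no nonzero $T$-reducing subspace on which $T$ is unitary. Put $D_T=(I-T^*T)^{1/2}$, $D_{T^*}=(I-TT^* )^{1/2}$, $\mathcal{D}_T=\overline{\mathrm{Ran}\,D_T}$, $\mathcal{D}_{T^*}=\overline{\mathrm{Ran}\,D_{T^*}}$. The characteristic function of $T$ is $\Theta_T(z)=[-T+zD_{T^*}(I-zT^* )^{-1}D_T]|_{\mathcal{D}_T}\in\mathcal{L}(\mathcal{D}_T,\mathcal{D}_{T^*})$, $z\in\mathbb{D}$ (constants, including $0$, have degree $0$). The order of a nilpotent operator $N$ is the smallest integer $p\ge 0$ with $N^p=0$ ($N^0=I$). Entries $*$ are unspecified and the spaces may be $\{0\}$. A pure shift is a unilateral shift of some multiplicity (an isometry without unitary part); a pure co-shift is the adjoint of a pure shift. For $T$ c.n.u. with $\Theta_T$ a polynomial of degree $n$, consider all orthogonal decompositions of $\mathcal{H}$ into three subspaces for which $T$ is block upper triangular with diagonal entries (pure shift, nilpotent of order $n$, pure co-shift). The canonical representation is the one on $\mathcal{H}_1\oplus\mathcal{H}_0\oplus\mathcal{H}_{-1}$ whose first space is minimal and third space is maximal among all of them; explicitly $\mathcal{H}_1=\overline{\mathrm{span}}\{T^kh: h\in\mathcal{D}_{T^*},k\ge n\}$, $\mathcal{H}_{-1}=\{h\in\mathcal{H}:\|T^{*(k+1)}h\|=\|T^{*k}h\|,\ k\ge0\}$, $\mathcal{H}_0=\mathcal{H}\ominus(\mathcal{H}_1\oplus\mathcal{H}_{-1})$. The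 $*$-canonical representation is the one on $\mathcal{H}_{1*}\oplus\mathcal{H}_{0*}\oplus\mathcal{H}_{-1*}$ whose first space is maximal and third space is minimal; explicitly $\mathcal{H}_{1*}=\{h\in\mathcal{H}:\|T^{k+1}h\|=\|T^kh\|,\ k\ge0\}$, $\mathcal{H}_{-1*}=\overline{\mathrm{span}}\{T^{*k}h:h\in\mathcal{D}_T,k\ge n\}$, $\mathcal{H}_{0*}=\mathcal{H}\ominus(\mathcal{H}_{1*}\oplus\mathcal{H}_{-1*})$. *)

theory Defs
  imports "HOL-Analysis.Analysis"
begin

section \<open>Complex Hilbert spaces\<close>

class complex_vector = real_vector +
  fixes scaleC :: "complex \<Rightarrow> 'a \<Rightarrow> 'a" (infixr "*\<^sub>C" 75)
  assumes scaleC_add_right: "c *\<^sub>C (x + y) = c *\<^sub>C x + c *\<^sub>C y"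
    and scaleC_add_left: "(c + d) *\<^sub>C x = c *\<^sub>C x + d *\<^sub>C x"
    and scaleC_scaleC: "c *\<^sub>C (d *\<^sub>C x) = (c * d) *\<^sub>C x"
    and scaleC_one: "1 *\<^sub>C x = x"
    and scaleR_scaleC: "r *\<^sub>R x = complex_of_real r *\<^sub>C x"

text \<open>
  The complex inner product is linear in its first argument. Its real part is the library's real
  inner product, so norm, topology and orthogonality lemmas of \<open>real_inner\<close> remain available;
  positive definiteness of \<open>cinner\<close> follows from that of \<open>inner\<close>.
\<close>

class complex_inner = complex_vector + real_inner +
  fixes cinner :: "'a \<Rightarrow> 'a \<Rightarrow> complex"
  assumes cinner_commute: "cinner x y = cnj (cinner y x)"
    and cinner_add_left: "cinner (x + y) z = cinner x z + cinner y z"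
    and cinner_scaleC_left: "cinner (c *\<^sub>C x) y = c * cinner x y"
    and inner_eq_Re_cinner: "inner x y = Re (cinner x y)"

class complex_hilbert = complex_inner + complete_space

definition csubspace :: "'a::complex_vector set \<Rightarrow> bool" where
  "csubspace M \<longleftrightarrow>
     0 \<in> M \<and> (\<forall>x\<in>M. \<forall>y\<in>M. x + y \<in> M) \<and> (\<forall>c. \<forall>x\<in>M. c *\<^sub>C x \<in> M)"

definition closed_csubspace :: "'a::complex_inner set \<Rightarrow> bool" where
  "closed_csubspace M \<longleftrightarrow> csubspace M \<and> closed M"

definition closed_cspan :: "'a::complex_inner set \<Rightarrow> 'a set" where
  "closed_cspan X = closure (csubspace hull X)"

definition orthogonal_sets :: "'a::complex_inner set \<Rightarrow> 'a set \<Rightarrow> bool" where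
  "orthogonal_sets K L \<longleftrightarrow> (\<forall>x\<in>K. \<forall>y\<in>L. cinner x y = 0)"

text \<open>\<open>ortho_minus K M\<close> is \<open>K \<ominus> M\<close>.\<close>

definition ortho_minus :: "'a::complex_inner set \<Rightarrow> 'a set \<Rightarrow> 'a set" where
  "ortho_minus K M = {x\<in>K. \<forall>m\<in>M. cinner x m = 0}"

definition ortho_proj :: "'a::complex_inner set \<Rightarrow> 'a \<Rightarrow> 'a" where
  "ortho_proj M x = (THE y. y \<in> M \<and> (\<forall>m\<in>M. cinner (x - y) m = 0))"


section \<open>Operators on and between closed subspaces\<close>

text \<open>
  An operator between closed subspaces \<open>K\<close> and \<open>L\<close> is represented by a function on the ambient
  space, of which only the values on \<open>K\<close> matter. An operator on the whole space is the
  case \<open>K = L = UNIV\<close>.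
\<close>

definition operator_on :: "'a::complex_inner set \<Rightarrow> 'a set \<Rightarrow> ('a \<Rightarrow> 'a) \<Rightarrow> bool" where
  "operator_on K L A \<longleftrightarrow>
     (\<forall>x\<in>K. A x \<in> L) \<and>
     (\<forall>x\<in>K. \<forall>y\<in>K. A (x + y) = A x + A y) \<and>
     (\<forall>c. \<forall>x\<in>K. A (c *\<^sub>C x) = c *\<^sub>C A x) \<and>
     (\<exists>b. \<forall>x\<in>K. norm (A x) \<le> b * norm x)"

definition contraction :: "('a::complex_inner \<Rightarrow> 'a) \<Rightarrow> bool" where
  "contraction T \<longleftrightarrow> operator_on UNIV UNIV T \<and> (\<forall>x. norm (T x) \<le> norm x)"

definition isometry_on :: "'a::complex_inner set \<Rightarrow> 'a set \<Rightarrow> ('a \<Rightarrow> 'a) \<Rightarrow> bool" where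
  "isometry_on K L V \<longleftrightarrow> operator_on K L V \<and> (\<forall>x\<in>K. norm (V x) = norm x)"

definition unitary_on :: "'a::complex_inner set \<Rightarrow> 'a set \<Rightarrow> ('a \<Rightarrow> 'a) \<Rightarrow> bool" where
  "unitary_on K L U \<longleftrightarrow> isometry_on K L U \<and> U ` K = L"

definition unitarily_equivalent ::
  "'a::complex_inner set \<Rightarrow> ('a \<Rightarrow> 'a) \<Rightarrow> 'a set \<Rightarrow> ('a \<Rightarrow> 'a) \<Rightarrow> bool" where
  "unitarily_equivalent K A L B \<longleftrightarrow>
     (\<exists>U. unitary_on K L U \<and> (\<forall>x\<in>K. U (A x) = B (U x)))"

definition reducing :: "'a::complex_inner set \<Rightarrow> ('a \<Rightarrow> 'a) \<Rightarrow> 'a set \<Rightarrow> bool" where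
  "reducing K A M \<longleftrightarrow>
     closed_csubspace M \<and> M \<subseteq> K \<and> A ` M \<subseteq> M \<and> A ` ortho_minus K M \<subseteq> ortho_minus K M"

definition completely_nonunitary :: "'a::complex_inner set \<Rightarrow> ('a \<Rightarrow> 'a) \<Rightarrow> bool" where
  "completely_nonunitary K A \<longleftrightarrow> \<not> (\<exists>M. M \<noteq> {0} \<and> reducing K A M \<and> unitary_on M M A)"

definition pure_shift :: "'a::complex_inner set \<Rightarrow> ('a \<Rightarrow> 'a) \<Rightarrow> bool" where
  "pure_shift K V \<longleftrightarrow> isometry_on K K V \<and> completely_nonunitary K V"

definition pure_coshift :: "'a::complex_inner set \<Rightarrow> ('a \<Rightarrow> 'a) \<Rightarrow> bool" where
  "pure_coshift K C \<longleftrightarrow> operator_on K K C \<and>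
     (\<exists>V. pure_shift K V \<and> (\<forall>x\<in>K. \<forall>y\<in>K. cinner (V x) y = cinner x (C y)))"

text \<open>In particular the only nilpotent operator of order \<open>0\<close> is the one on \<open>{0}\<close>.\<close>

definition nilpotent_of_order :: "nat \<Rightarrow> 'a::complex_inner set \<Rightarrow> ('a \<Rightarrow> 'a) \<Rightarrow> bool" where
  "nilpotent_of_order p K N \<longleftrightarrow> operator_on K K N \<and>
     (\<forall>x\<in>K. (N ^^ p) x = 0) \<and> (\<forall>q<p. \<exists>x\<in>K. (N ^^ q) x \<noteq> 0)"


section \<open>Defect operators and characteristic function\<close>

definition cadjoint :: "('a::complex_inner \<Rightarrow> 'a) \<Rightarrow> 'a \<Rightarrow> 'a" where
  "cadjoint T = (THE R. \<forall>x y. cinner (T x) y = cinner x (R y))"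

definition positive_operator :: "('a::complex_inner \<Rightarrow> 'a) \<Rightarrow> bool" where
  "positive_operator A \<longleftrightarrow>
     operator_on UNIV UNIV A \<and> (\<forall>x. cinner (A x) x \<in> \<real> \<and> 0 \<le> Re (cinner (A x) x))"

definition positive_sqrt :: "('a::complex_inner \<Rightarrow> 'a) \<Rightarrow> 'a \<Rightarrow> 'a" where
  "positive_sqrt A = (THE B. positive_operator B \<and> B \<circ> B = A)"

text \<open>\<open>D\<^sub>T\<close> and the closure of its range; \<open>D\<^sub>T\<^sub>*\<close> is \<open>defect_op (cadjoint T)\<close>, as \<open>T\<^sup>*\<^sup>* = T\<close>.\<close>

definition defect_op :: "('a::complex_inner \<Rightarrow> 'a) \<Rightarrow> 'a \<Rightarrow> 'a" where
  "defect_op T = positive_sqrt (\<lambda>x. x - cadjoint T (T x))"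

definition defect_space :: "('a::complex_inner \<Rightarrow> 'a) \<Rightarrow> 'a set" where
  "defect_space T = closure (range (defect_op T))"

definition char_fun :: "('a::complex_inner \<Rightarrow> 'a) \<Rightarrow> complex \<Rightarrow> 'a \<Rightarrow> 'a" where
  "char_fun T z x =
     - T x + z *\<^sub>C defect_op (cadjoint T) (inv (\<lambda>y. y - z *\<^sub>C cadjoint T y) (defect_op T x))"

text \<open>
  \<open>F\<close> agrees on the unit disc with a polynomial of degree \<open>n\<close> whose coefficients are bounded
  operators from \<open>K\<close> to \<open>L\<close>; constants, including \<open>0\<close>, have degree \<open>0\<close>.
\<close>

definition operator_polynomial ::
  "'a::complex_inner set \<Rightarrow> 'a set \<Rightarrow> (complex \<Rightarrow> 'a \<Rightarrow> 'a) \<Rightarrow> nat \<Rightarrow> bool" where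
  "operator_polynomial K L F n \<longleftrightarrow>
     (\<exists>A. (\<forall>k\<le>n. operator_on K L (A k)) \<and>
          (\<forall>z\<in>ball 0 1. \<forall>x\<in>K. F z x = (\<Sum>k\<le>n. z ^ k *\<^sub>C A k x)) \<and>
          (n = 0 \<or> (\<exists>x\<in>K. A n x \<noteq> 0)))"

definition char_fun_polynomial :: "('a::complex_inner \<Rightarrow> 'a) \<Rightarrow> nat \<Rightarrow> bool" where
  "char_fun_polynomial T n \<longleftrightarrow>
     operator_polynomial (defect_space T) (defect_space (cadjoint T)) (char_fun T) n"


section \<open>Triangular representations\<close>

definition orthogonal_decomposition ::
  "'a::complex_inner set \<Rightarrow> 'a set \<Rightarrow> 'a set \<Rightarrow> bool" where
  "orthogonal_decomposition K1 K0 Km \<longleftrightarrow>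
     closed_csubspace K1 \<and> closed_csubspace K0 \<and> closed_csubspace Km \<and>
     orthogonal_sets K1 K0 \<and> orthogonal_sets K1 Km \<and> orthogonal_sets K0 Km \<and>
     (\<forall>x. \<exists>a\<in>K1. \<exists>b\<in>K0. \<exists>c\<in>Km. x = a + b + c)"

text \<open>
  \<open>block L T\<close>, restricted to \<open>K\<close>, is the matrix entry of \<open>T\<close> from \<open>K\<close> to \<open>L\<close>. In particular
  \<open>block K T\<close>, regarded as an operator on \<open>K\<close>, is the diagonal entry of \<open>T\<close> at \<open>K\<close>.
\<close>

definition block :: "'a::complex_inner set \<Rightarrow> ('a \<Rightarrow> 'a) \<Rightarrow> 'a \<Rightarrow> 'a" where
  "block L T x = ortho_proj L (T x)"

definition triangular_representation ::
  "('a::complex_inner \<Rightarrow> 'a) \<Rightarrow> nat \<Rightarrow> 'a set \<Rightarrow> 'a set \<Rightarrow> 'a set \<Rightarrow> bool" where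
  "triangular_representation T n K1 K0 Km \<longleftrightarrow>
     orthogonal_decomposition K1 K0 Km \<and>
     (\<forall>x\<in>K1. block K0 T x = 0) \<and> (\<forall>x\<in>K1. block Km T x = 0) \<and> (\<forall>x\<in>K0. block Km T x = 0) \<and>
     pure_shift K1 (block K1 T) \<and>
     nilpotent_of_order n K0 (block K0 T) \<and>
     pure_coshift Km (block Km T)"

text \<open>
  The spaces of the canonical and of the \<open>*\<close>-canonical representation of \<open>T\<close>, with diagonal
  entries in the order shift, nilpotent, co-shift.
\<close>

definition canonical_spaces ::
  "('a::complex_inner \<Rightarrow> 'a) \<Rightarrow> nat \<Rightarrow> 'a set \<times> 'a set \<times> 'a set" where
  "canonical_spaces T n =
     (let H1 = closed_cspan {(T ^^ k) h | k h. n \<le> k \<and> h \<in> defect_space (cadjoint T)};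
          Hm = {h. \<forall>k. norm ((cadjoint T ^^ (k + 1)) h) = norm ((cadjoint T ^^ k) h)}
      in (H1, ortho_minus UNIV {a + b | a b. a \<in> H1 \<and> b \<in> Hm}, Hm))"

definition star_canonical_spaces ::
  "('a::complex_inner \<Rightarrow> 'a) \<Rightarrow> nat \<Rightarrow> 'a set \<times> 'a set \<times> 'a set" where
  "star_canonical_spaces T n =
     (let H1 = {h. \<forall>k. norm ((T ^^ (k + 1)) h) = norm ((T ^^ k) h)};
          Hm = closed_cspan {(cadjoint T ^^ k) h | k h. n \<le> k \<and> h \<in> defect_space T}
      in (H1, ortho_minus UNIV {a + b | a b. a \<in> H1 \<and> b \<in> Hm}, Hm))"

end

theory Submission
  imports Defs
begin

text \<open>
  Pure shifts are classified up to unitary equivalence by the dimension of their wandering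
  subspace, so one has to see that this dimension does not depend on the representation. Let \<open>I\<close> be
  the largest subspace on which all powers of \<open>T\<close> are isometric (\<open>isometric_part\<close>); it is the
  first space of the \<open>*\<close>-canonical representation. Call a closed invariant subspace \<open>B\<close> of \<open>I\<close>
  \<^emph>\<open>absorbing\<close> if the distance of \<open>T\<^sup>k h\<close> to \<open>B\<close> tends to \<open>0\<close> for every \<open>h\<close> in \<open>I\<close>. In terms of the
  unitary dilation this means that \<open>B\<close> and \<open>I\<close> generate the same bilateral shift, and it forces
  the two multiplicities to agree.

  The first spaces of all the representations are absorbing, by \<open>absorbingI\<close>. If \<open>C\<close> is a
  \<open>T\<^sup>*\<close>-invariant subspace on which \<open>T\<^sup>*\<close> is isometric, then \<open>T\<^sup>*\<close> restricted to \<open>C\<close> is a pure shift,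
  because \<open>T\<close> is completely non unitary; hence the component of \<open>T\<^sup>k h\<close> in \<open>C\<close> tends to \<open>0\<close>. If
  moreover \<open>T\<^sup>n\<close> maps the orthogonal complement of \<open>C\<close> into \<open>B\<close>, then \<open>T\<^sup>k\<^sup>+\<^sup>n h\<close> gets close to \<open>B\<close>.
  In a triangular representation, \<open>T\<^sup>n\<close> does this with the third space as \<open>C\<close> and the first as
  \<open>B\<close>, by nilpotency of order \<open>n\<close> in the middle (\<open>absorbing_triangular\<close>); for the canonical spaces it
  follows from their definition, and the degree of \<open>\<Theta>\<^sub>T\<close> enters only to place the span of the
  \<open>T\<^sup>k \<D>\<^sub>T\<^sub>*\<close>, \<open>k \<ge> n\<close>, inside \<open>I\<close>: the Taylor coefficients \<open>D\<^sub>T\<^sub>* T\<^sup>*\<^sup>k D\<^sub>T\<close> vanish for \<open>k \<ge> n\<close>, so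
  \<open>T\<close> is isometric on these vectors (\<open>absorbing_closed_cspan\<close>).

  The multiplicities are compared by a count due to Halmos (\<open>multiplicity_le\<close>). Let \<open>w\<close> range over
  orthonormal wandering vectors of one absorbing space and \<open>e\<close> over an orthonormal basis of the
  wandering subspace of another. The sum of \<open>\<bar>\<langle>T\<^sup>k w, T\<^sup>l e\<rangle>\<bar>\<^sup>2\<close> over all \<open>w\<close> and \<open>l\<close> is at most \<open>1\<close> for
  each \<open>e\<close>, and summed over \<open>e\<close> and \<open>l\<close> it tends to \<open>1\<close> for each \<open>w\<close> as \<open>k\<close> grows. So there
  are at most as many \<open>w\<close> as \<open>e\<close>. Separability settles the case of infinite multiplicity.

  Everything is symmetric in \<open>T\<close> and \<open>T\<^sup>*\<close>. For \<open>T\<^sup>*\<close> it shows that the restrictions of \<open>T\<^sup>*\<close> to the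
  third spaces are unitarily equivalent, and the co-shifts are their adjoints.
\<close>

section \<open>Complex inner products\<close>

instance complex_hilbert \<subseteq> banach ..

lemma cinner_zero_left [simp]: "cinner 0 (x::'a::complex_inner) = 0"
  using cinner_add_left[of 0 0 x] by simp

lemma cinner_zero_right [simp]: "cinner (x::'a::complex_inner) 0 = 0"
  by (metis cinner_commute cinner_zero_left complex_cnj_zero)

lemma cinner_add_right: "cinner x (y + z) = cinner x y + cinner (x::'a::complex_inner) z"
  by (metis cinner_add_left cinner_commute complex_cnj_add)

lemma cinner_scaleC_right: "cinner x (c *\<^sub>C y) = cnj c * cinner (x::'a::complex_inner) y"
  by (metis cinner_scaleC_left cinner_commute complex_cnj_mult)

lemma cinner_scaleR_left: "cinner (r *\<^sub>R x) y = r *\<^sub>R cinner (x::'a::complex_inner) y"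
  by (simp add: scaleR_scaleC cinner_scaleC_left scaleR_conv_of_real)

lemma cinner_scaleR_right: "cinner x (r *\<^sub>R y) = r *\<^sub>R cinner (x::'a::complex_inner) y"
  by (simp add: scaleR_scaleC cinner_scaleC_right scaleR_conv_of_real)

lemma cinner_minus_left [simp]: "cinner (- x) y = - cinner (x::'a::complex_inner) y"
  using cinner_scaleR_left[of "-1" x y] by simp

lemma cinner_minus_right [simp]: "cinner x (- y) = - cinner (x::'a::complex_inner) y"
  using cinner_scaleR_right[of x "-1" y] by simp

lemma cinner_diff_left: "cinner (x - y) z = cinner x z - cinner (y::'a::complex_inner) z"
  using cinner_add_left[of x "- y" z] by simp

lemma cinner_diff_right: "cinner x (y - z) = cinner x y - cinner (x::'a::complex_inner) z"
  using cinner_add_right[of x y "- z"] by simp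

lemma cinner_self: "cinner x x = complex_of_real ((norm (x::'a::complex_inner))\<^sup>2)"
proof -
  have "Im (cinner x x) = 0"
    using cinner_commute[of x x] by (metis complex_cnj_cancel_iff Reals_cnj_iff complex_is_Real_iff)
  moreover have "Re (cinner x x) = (norm x)\<^sup>2"
    by (simp add: inner_eq_Re_cinner[symmetric] power2_norm_eq_inner)
  ultimately show ?thesis by (simp add: complex_eq_iff)
qed

lemma cinner_self_eq_0 [simp]: "cinner x x = 0 \<longleftrightarrow> (x::'a::complex_inner) = 0"
  by (simp add: cinner_self)

lemma norm_scaleC [simp]: "norm (c *\<^sub>C (x::'a::complex_inner)) = cmod c * norm x"
proof -
  have "complex_of_real ((norm (c *\<^sub>C x))\<^sup>2) = c * cnj c * complex_of_real ((norm x)\<^sup>2)"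
    unfolding cinner_self[symmetric] by (simp add: cinner_scaleC_left cinner_scaleC_right)
  also have "\<dots> = complex_of_real ((cmod c * norm x)\<^sup>2)"
    by (simp add: complex_norm_square[symmetric] power_mult_distrib)
  finally have "(norm (c *\<^sub>C x))\<^sup>2 = (cmod c * norm x)\<^sup>2"
    using of_real_eq_iff by blast
  thus ?thesis by (simp add: power2_eq_iff_nonneg)
qed

lemma cmod_cinner_le: "cmod (cinner x y) \<le> norm (x::'a::complex_inner) * norm y"
proof (cases "cinner x y = 0")
  case False
  \<comment> \<open>Rotating \<open>x\<close> by a phase makes the complex inner product real.\<close>
  define c where "c = cnj (sgn (cinner x y))"
  have c: "cmod c = 1" using False by (simp add: c_def norm_sgn)
  have "cinner (c *\<^sub>C x) y = complex_of_real (cmod (cinner x y))"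
  proof -
    have "c * cinner x y * cmod (cinner x y) = cnj (cinner x y) * cinner x y"
      using False by (simp add: c_def sgn_eq)
    also have "\<dots> = complex_of_real (cmod (cinner x y)) * cmod (cinner x y)"
      by (simp add: mult.commute complex_norm_square[symmetric] power2_eq_square)
    finally show ?thesis using False by (simp add: cinner_scaleC_left)
  qed
  hence "cmod (cinner x y) = inner (c *\<^sub>C x) y" by (simp add: inner_eq_Re_cinner)
  also have "\<dots> \<le> norm (c *\<^sub>C x) * norm y" by (rule norm_cauchy_schwarz)
  finally show ?thesis by (simp add: c)
qed auto

interpretation cinner: bounded_bilinear "cinner :: 'a::complex_inner \<Rightarrow> 'a \<Rightarrow> complex"
proof
  show "\<exists>K. \<forall>a b::'a. norm (cinner a b) \<le> norm a * norm b * K"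
    by (rule exI[of _ 1]) (simp add: cmod_cinner_le)
qed (auto simp: cinner_add_left cinner_add_right cinner_scaleR_left cinner_scaleR_right)

lemma bounded_linear_scaleC: "bounded_linear (\<lambda>x::'a::complex_inner. c *\<^sub>C x)"
proof (rule bounded_linear_intro[where K = "cmod c"])
  show "c *\<^sub>C (r *\<^sub>R x) = r *\<^sub>R (c *\<^sub>C x)" for r and x::'a
    by (simp add: scaleR_scaleC scaleC_scaleC mult.commute)
qed (auto simp: scaleC_add_right mult.commute)

lemma scaleC_minus1: "(-1) *\<^sub>C x = - (x::'a::complex_inner)"
  using scaleR_scaleC[of "-1" x] by simp

lemma scaleC_zero_left [simp]: "0 *\<^sub>C x = (0::'a::complex_inner)"
  using scaleR_scaleC[of "0" x] by simp

lemma scaleC_zero_right [simp]: "c *\<^sub>C 0 = (0::'a::complex_inner)"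
  using linear_simps(3)[OF bounded_linear_scaleC[of c]] by simp

lemma scaleC_diff_right: "c *\<^sub>C (x - y) = c *\<^sub>C x - c *\<^sub>C (y::'a::complex_inner)"
  by (rule linear_simps(2)[OF bounded_linear_scaleC])

lemma cinner_eqI:
  fixes x y :: "'a::complex_inner"
  assumes "\<And>z. cinner x z = cinner y z"
  shows "x = y"
proof -
  have "cinner (x - y) (x - y) = 0" by (simp add: cinner_diff_left assms)
  thus ?thesis by simp
qed

lemma csubspace_diff: "csubspace M \<Longrightarrow> x \<in> M \<Longrightarrow> y \<in> M \<Longrightarrow> x - y \<in> (M :: 'a::complex_inner set)"
  unfolding csubspace_def by (metis add_uminus_conv_diff scaleC_minus1)

lemma csubspace_sum:
  "csubspace M \<Longrightarrow> (\<And>i. i \<in> F \<Longrightarrow> f i \<in> M) \<Longrightarrow> sum f F \<in> M"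
  by (induction F rule: infinite_finite_induct) (auto simp: csubspace_def)

section \<open>Orthonormal families\<close>

definition orthonormal_family :: "('i \<Rightarrow> 'a::complex_inner) \<Rightarrow> 'i set \<Rightarrow> bool" where
  "orthonormal_family e I \<longleftrightarrow> (\<forall>i\<in>I. \<forall>j\<in>I. cinner (e i) (e j) = (if i = j then 1 else 0))"

text \<open>For a closed subspace \<open>M\<close> of a Hilbert space this is equivalent to the span of the family being
  dense in \<open>M\<close>; the form by orthogonality is the one that Wold's theorem supplies.\<close>

definition total_in :: "('i \<Rightarrow> 'a::complex_inner) \<Rightarrow> 'i set \<Rightarrow> 'a set \<Rightarrow> bool" where
  "total_in e I M \<longleftrightarrow> e ` I \<subseteq> M \<and> (\<forall>x\<in>M. (\<forall>i\<in>I. cinner x (e i) = 0) \<longrightarrow> x = 0)"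

lemma cinner_sum_orthonormal:
  assumes "orthonormal_family e I" "finite F" "F \<subseteq> I" "i \<in> I"
  shows "cinner (\<Sum>j\<in>F. c j *\<^sub>C e j) (e i) = (if i \<in> F then c i else 0)"
proof -
  have "cinner (\<Sum>j\<in>F. c j *\<^sub>C e j) (e i) = (\<Sum>j\<in>F. c j * cinner (e j) (e i))"
    by (simp add: cinner.sum_left cinner_scaleC_left)
  also have "\<dots> = (\<Sum>j\<in>F. if j = i then c i else 0)"
    using assms by (intro sum.cong) (auto simp: orthonormal_family_def)
  finally show ?thesis using assms by simp
qed

lemma norm_sum_orthonormal:
  assumes "orthonormal_family e I" "finite F" "F \<subseteq> I"
  shows "(norm (\<Sum>i\<in>F. c i *\<^sub>C e i))\<^sup>2 = (\<Sum>i\<in>F. (cmod (c i))\<^sup>2)"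
proof -
  let ?s = "\<Sum>i\<in>F. c i *\<^sub>C e i"
  have "cinner ?s ?s = (\<Sum>i\<in>F. cnj (c i) * cinner ?s (e i))"
    by (subst cinner.sum_right) (simp add: cinner_scaleC_right)
  also have "\<dots> = (\<Sum>i\<in>F. cnj (c i) * c i)"
    using assms(3) by (intro sum.cong) (auto simp: cinner_sum_orthonormal[OF assms])
  also have "\<dots> = complex_of_real (\<Sum>i\<in>F. (cmod (c i))\<^sup>2)"
    unfolding of_real_sum complex_norm_square by (simp add: mult.commute)
  finally show ?thesis unfolding cinner_self using of_real_eq_iff by blast
qed

lemma bessel:
  assumes "orthonormal_family e I" "finite F" "F \<subseteq> I"
  shows "(\<Sum>i\<in>F. (cmod (cinner x (e i)))\<^sup>2) \<le> (norm x)\<^sup>2"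
proof -
  let ?s = "\<Sum>i\<in>F. cinner x (e i) *\<^sub>C e i"
  have ss: "(norm ?s)\<^sup>2 = (\<Sum>i\<in>F. (cmod (cinner x (e i)))\<^sup>2)"
    by (rule norm_sum_orthonormal[OF assms])
  have "cinner x ?s = (\<Sum>i\<in>F. cnj (cinner x (e i)) * cinner x (e i))"
    by (simp add: cinner.sum_right cinner_scaleC_right)
  also have "\<dots> = complex_of_real (\<Sum>i\<in>F. (cmod (cinner x (e i)))\<^sup>2)"
    unfolding of_real_sum complex_norm_square by (simp add: mult.commute)
  finally have xs: "cinner x ?s = complex_of_real ((norm ?s)\<^sup>2)" by (simp add: ss)
  have "(norm ?s)\<^sup>2 \<le> norm x * norm ?s"
    using cmod_cinner_le[of x ?s] unfolding xs by (simp add: norm_power)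
  hence "norm ?s \<le> norm x" 
    by (cases "norm ?s = 0") (auto simp: power2_eq_square)
  thus ?thesis unfolding ss[symmetric] by (simp add: power_mono)
qed

lemma has_sum_in_closed_csubspace:
  fixes M :: "'a::complex_inner set"
  assumes "(f has_sum s) I" "closed_csubspace M" "\<And>i. i \<in> I \<Longrightarrow> f i \<in> M"
  shows "s \<in> M"
proof (rule Lim_in_closed_set)
  show "closed M" using assms(2) by (simp add: closed_csubspace_def)
  show "(sum f \<longlongrightarrow> s) (finite_subsets_at_top I)" using assms(1) by (simp add: has_sum_def)
  show "\<forall>\<^sub>F F in finite_subsets_at_top I. sum f F \<in> M"
    using assms(2,3) by (intro eventually_finite_subsets_at_top_weakI csubspace_sum)
      (auto simp: closed_csubspace_def)
qed auto

text \<open>Partial sums of an orthonormal series form a Cauchy net as soon as those of the squared coefficients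
  do. Together with the existence of maximal orthonormal sets this yields orthogonal projections and
  adjoints without a minimization argument.\<close>

lemma riesz_fischer:
  fixes e :: "'i \<Rightarrow> 'a::complex_hilbert"
  assumes on: "orthonormal_family e I"
    and bdd: "\<And>F. finite F \<Longrightarrow> F \<subseteq> I \<Longrightarrow> (\<Sum>i\<in>F. (cmod (c i))\<^sup>2) \<le> b"
  shows "\<exists>s. ((\<lambda>i. c i *\<^sub>C e i) has_sum s) I \<and> (\<forall>i\<in>I. cinner s (e i) = c i) \<and>
    ((\<lambda>i. (cmod (c i))\<^sup>2) has_sum (norm s)\<^sup>2) I"
proof -
  let ?f = "\<lambda>i. c i *\<^sub>C e i" and ?g = "\<lambda>i. (cmod (c i))\<^sup>2"
  obtain L where L: "(?g has_sum L) I"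
  proof -
    have "bdd_above (sum ?g ` {F. F \<subseteq> I \<and> finite F})"
      using bdd by (auto intro!: bdd_aboveI)
    hence "?g summable_on I" by (intro nonneg_bdd_above_summable_on) auto
    thus ?thesis using that by (auto simp: summable_on_def)
  qed
  have "cauchy_filter (filtermap (sum ?f) (finite_subsets_at_top I))"
    unfolding cauchy_filter_metric_filtermap
  proof (intro allI impI)
    fix d :: real assume d: "d > 0"
    have "\<forall>\<^sub>F F in finite_subsets_at_top I. dist (sum ?g F) L < d\<^sup>2 / 8"
      using tendstoD[OF L[unfolded has_sum_def], of "d\<^sup>2 / 8"] d by simp
    then obtain F0 where F0: "finite F0" "F0 \<subseteq> I"
      and near: "\<And>F. finite F \<Longrightarrow> F0 \<subseteq> F \<Longrightarrow> F \<subseteq> I \<Longrightarrow> dist (sum ?g F) L < d\<^sup>2 / 8"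
      unfolding eventually_finite_subsets_at_top by (elim exE conjE) simp
    have close: "dist (sum ?f F) (sum ?f F0) < d / 2"
      if F: "finite F" "F0 \<subseteq> F" "F \<subseteq> I" for F
    proof -
      have "(dist (sum ?f F) (sum ?f F0))\<^sup>2 = (norm (sum ?f (F - F0)))\<^sup>2"
        using F by (simp add: dist_norm sum_diff)
      also have "\<dots> = sum ?g (F - F0)"
        using F by (intro norm_sum_orthonormal[OF on]) auto
      also have "\<dots> = sum ?g F - sum ?g F0"
        using F by (simp add: sum_diff)
      also have "\<dots> < (d / 2)\<^sup>2"
      proof -
        have "dist (sum ?g F) L < d\<^sup>2 / 8" "dist (sum ?g F0) L < d\<^sup>2 / 8"
          using near[OF F] near[OF F0(1) _ F0(2)] by simp_all
        hence "sum ?g F - sum ?g F0 < d\<^sup>2 / 4" unfolding dist_real_def by linarith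
        thus ?thesis by (simp add: power_divide)
      qed
      finally show ?thesis by (rule power_less_imp_less_base) (use d in simp)
    qed
    show "\<exists>P. eventually P (finite_subsets_at_top I) \<and>
        (\<forall>x y. P x \<and> P y \<longrightarrow> dist (sum ?f x) (sum ?f y) < d)"
    proof (intro exI conjI allI impI)
      show "\<forall>\<^sub>F F in finite_subsets_at_top I. finite F \<and> F0 \<subseteq> F \<and> F \<subseteq> I"
        unfolding eventually_finite_subsets_at_top using F0 by (intro exI[of _ F0]) auto
      fix F G assume "(finite F \<and> F0 \<subseteq> F \<and> F \<subseteq> I) \<and> (finite G \<and> F0 \<subseteq> G \<and> G \<subseteq> I)"
      thus "dist (sum ?f F) (sum ?f G) < d"
        using close[of F] close[of G] dist_triangle2[of "sum ?f F" "sum ?f G" "sum ?f F0"] by auto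
    qed
  qed
  moreover have "complete (UNIV::'a set)"
    by (meson Cauchy_convergent UNIV_I complete_def convergent_def)
  ultimately obtain s where "(sum ?f \<longlongrightarrow> s) (finite_subsets_at_top I)"
    using complete_uniform[where S=UNIV] by (force simp add: filterlim_def)
  hence s: "(?f has_sum s) I" by (simp add: has_sum_def)
  show ?thesis
  proof (intro exI[of _ s] conjI ballI)
    show "(?f has_sum s) I" by (rule s)
    fix i assume i: "i \<in> I"
    have lim: "((\<lambda>F. cinner (sum ?f F) (e i)) \<longlongrightarrow> cinner s (e i)) (finite_subsets_at_top I)"
      using s by (intro cinner.tendsto tendsto_const) (simp add: has_sum_def)
    have "\<forall>\<^sub>F F in finite_subsets_at_top I. cinner (sum ?f F) (e i) = c i"
      unfolding eventually_finite_subsets_at_top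
    proof (intro exI[of _ "{i}"] conjI allI impI)
      fix F assume F: "finite F \<and> {i} \<subseteq> F \<and> F \<subseteq> I"
      hence "cinner (sum ?f F) (e i) = (if i \<in> F then c i else 0)"
        using i by (intro cinner_sum_orthonormal[OF on]) auto
      thus "cinner (sum ?f F) (e i) = c i" using F by simp
    qed (use i in auto)
    hence "((\<lambda>F. cinner (sum ?f F) (e i)) \<longlongrightarrow> c i) (finite_subsets_at_top I)"
      by (rule tendsto_eventually)
    from tendsto_unique[OF finite_subsets_at_top_neq_bot lim this] show "cinner s (e i) = c i" .
  next
    have "((\<lambda>F. (norm (sum ?f F))\<^sup>2) \<longlongrightarrow> (norm s)\<^sup>2) (finite_subsets_at_top I)"
      using s by (intro tendsto_intros) (simp add: has_sum_def)
    moreover have "\<forall>\<^sub>F F in finite_subsets_at_top I. (norm (sum ?f F))\<^sup>2 = sum ?g F"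
      by (intro eventually_finite_subsets_at_top_weakI norm_sum_orthonormal[OF on])
    ultimately show "(?g has_sum (norm s)\<^sup>2) I"
      unfolding has_sum_def by (rule Lim_transform_eventually)
  qed
qed

lemma riesz_fischer_coefficients:
  fixes e :: "'i \<Rightarrow> 'a::complex_hilbert"
  assumes "orthonormal_family e I"
  shows "\<exists>s. ((\<lambda>i. cinner x (e i) *\<^sub>C e i) has_sum s) I \<and>
    (\<forall>i\<in>I. cinner s (e i) = cinner x (e i)) \<and>
    ((\<lambda>i. (cmod (cinner x (e i)))\<^sup>2) has_sum (norm s)\<^sup>2) I"
  by (rule riesz_fischer[OF assms bessel[OF assms]])

lemma total_in_eqI:
  assumes "total_in e I M" "csubspace M" "x \<in> M" "y \<in> M"
    and "\<And>i. i \<in> I \<Longrightarrow> cinner x (e i) = cinner y (e i)"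
  shows "x = y"
proof -
  have "x - y \<in> M" using assms csubspace_diff by blast
  moreover have "\<forall>i\<in>I. cinner (x - y) (e i) = 0" by (simp add: cinner_diff_left assms)
  ultimately show ?thesis using assms(1) by (auto simp: total_in_def)
qed

lemma fourier_expansion:
  fixes e :: "'i \<Rightarrow> 'a::complex_hilbert"
  assumes on: "orthonormal_family e I" and tot: "total_in e I M"
    and M: "closed_csubspace M" and x: "x \<in> M"
  shows "((\<lambda>i. cinner x (e i) *\<^sub>C e i) has_sum x) I"
    and "((\<lambda>i. (cmod (cinner x (e i)))\<^sup>2) has_sum (norm x)\<^sup>2) I"
proof -
  obtain s where s: "((\<lambda>i. cinner x (e i) *\<^sub>C e i) has_sum s) I"
    "\<forall>i\<in>I. cinner s (e i) = cinner x (e i)"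
    "((\<lambda>i. (cmod (cinner x (e i)))\<^sup>2) has_sum (norm s)\<^sup>2) I"
    using riesz_fischer_coefficients[OF on, of x] by (elim exE conjE)
  have "s \<in> M"
    using M tot by (intro has_sum_in_closed_csubspace[OF s(1)])
      (auto simp: total_in_def closed_csubspace_def csubspace_def)
  hence "s = x" using M x s(2) by (intro total_in_eqI[OF tot]) (auto simp: closed_csubspace_def)
  thus "((\<lambda>i. cinner x (e i) *\<^sub>C e i) has_sum x) I"
    "((\<lambda>i. (cmod (cinner x (e i)))\<^sup>2) has_sum (norm x)\<^sup>2) I" using s by auto
qed

text \<open>A maximal orthonormal subset of \<open>M\<close> is total: a vector of \<open>M\<close> orthogonal to it could be normalized
  and added.\<close>

lemma total_orthonormal_subset_exists:
  fixes M :: "'a::complex_inner set"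
  assumes M: "csubspace M"
  obtains E where "orthonormal_family (\<lambda>e. e) E" "total_in (\<lambda>e. e) E M"
proof -
  let ?A = "{E. E \<subseteq> M \<and> orthonormal_family (\<lambda>e. e) E}"
  have "\<exists>E\<in>?A. \<forall>X\<in>?A. E \<subseteq> X \<longrightarrow> X = E"
  proof (rule subset_Zorn')
    fix C assume C: "subset.chain ?A C"
    have "orthonormal_family (\<lambda>e. e) (\<Union>C)"
      unfolding orthonormal_family_def
    proof (intro ballI)
      fix i j assume "i \<in> \<Union>C" "j \<in> \<Union>C"
      then obtain X where "X \<in> C" "i \<in> X" "j \<in> X"
        using C unfolding subset_chain_def by blast
      moreover have "orthonormal_family (\<lambda>e. e) X"
        using C \<open>X \<in> C\<close> unfolding subset_chain_def by blast
      ultimately show "cinner i j = (if i = j then 1 else 0)" by (simp add: orthonormal_family_def)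
    qed
    thus "\<Union>C \<in> ?A" using C unfolding subset_chain_def by blast
  qed
  then obtain E where E: "E \<subseteq> M" "orthonormal_family (\<lambda>e. e) E"
    and max: "\<And>X. X \<subseteq> M \<Longrightarrow> orthonormal_family (\<lambda>e. e) X \<Longrightarrow> E \<subseteq> X \<Longrightarrow> X = E" by auto
  have "x = 0" if x: "x \<in> M" "\<forall>i\<in>E. cinner x i = 0" for x
  proof (rule ccontr)
    assume "x \<noteq> 0"
    define u where "u = complex_of_real (1 / norm x) *\<^sub>C x"
    have nu: "norm u = 1" using \<open>x \<noteq> 0\<close> by (simp add: u_def norm_divide)
    have u0: "cinner u i = 0" "cinner i u = 0" if "i \<in> E" for i
      using x that cinner_commute[of i u] by (auto simp: u_def cinner_scaleC_left)
    have "u \<notin> E" using u0(1)[of u] nu by auto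
    hence "orthonormal_family (\<lambda>e. e) (insert u E)"
      using E(2) u0 nu by (auto simp: orthonormal_family_def cinner_self[of u])
    moreover have "insert u E \<subseteq> M" using x E M by (auto simp: u_def csubspace_def)
    ultimately have "u \<in> E" using max by blast
    thus False using \<open>u \<notin> E\<close> by blast
  qed
  thus ?thesis using that E by (auto simp: total_in_def)
qed

section \<open>Orthogonal projections and adjoints\<close>

text \<open>The Fourier series of \<open>x\<close> along an orthonormal basis of \<open>M\<close> is the nearest point to \<open>x\<close>.\<close>

lemma ortho_decomposition_exists:
  fixes M :: "'a::complex_hilbert set"
  assumes M: "closed_csubspace M"
  obtains y where "y \<in> M" "\<And>m. m \<in> M \<Longrightarrow> cinner (x - y) m = 0"
proof -
  obtain E where E: "orthonormal_family (\<lambda>e. e) E" "total_in (\<lambda>e. e) E M"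
    using total_orthonormal_subset_exists M unfolding closed_csubspace_def by blast
  obtain y where y: "((\<lambda>i. cinner x i *\<^sub>C i) has_sum y) E"
    "\<forall>i\<in>E. cinner y i = cinner x i"
    using riesz_fischer_coefficients[OF E(1), of x] by (elim exE conjE)
  have "y \<in> M"
    using M E(2) by (intro has_sum_in_closed_csubspace[OF y(1)])
      (auto simp: total_in_def closed_csubspace_def csubspace_def)
  moreover have "cinner (x - y) m = 0" if m: "m \<in> M" for m
  proof -
    have "((\<lambda>i. cinner (x - y) (cinner m i *\<^sub>C i)) has_sum cinner (x - y) m) E"
      by (intro has_sum_bounded_linear[OF cinner.bounded_linear_right]
          fourier_expansion(1)[OF E M m])
    moreover have "((\<lambda>i. cinner (x - y) (cinner m i *\<^sub>C i)) has_sum 0) E"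
      by (intro has_sum_0) (simp add: cinner_scaleC_right cinner_diff_left y)
    ultimately show ?thesis using has_sum_unique by blast
  qed
  ultimately show ?thesis using that by blast
qed

lemma ortho_decomposition_unique:
  fixes M :: "'a::complex_inner set"
  assumes M: "csubspace M" and "y \<in> M" "\<And>m. m \<in> M \<Longrightarrow> cinner (x - y) m = 0"
    and "y' \<in> M" "\<And>m. m \<in> M \<Longrightarrow> cinner (x - y') m = 0"
  shows "y' = y"
proof -
  have "y' - y \<in> M" using assms csubspace_diff by blast
  hence "cinner (x - y) (y' - y) - cinner (x - y') (y' - y) = 0" using assms by simp
  moreover have "cinner (x - y) (y' - y) - cinner (x - y') (y' - y) = cinner (y' - y) (y' - y)"
    by (simp only: cinner_diff_left) simp
  ultimately show ?thesis by simp
qed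

lemma ortho_projI:
  fixes M :: "'a::complex_inner set"
  assumes "csubspace M" "y \<in> M" "\<And>m. m \<in> M \<Longrightarrow> cinner (x - y) m = 0"
  shows "ortho_proj M x = y"
  unfolding ortho_proj_def
  using assms ortho_decomposition_unique[OF assms] by (intro the_equality) blast+

lemma ortho_proj:
  fixes M :: "'a::complex_hilbert set"
  assumes M: "closed_csubspace M"
  shows ortho_proj_in: "ortho_proj M x \<in> M"
    and cinner_ortho_proj_left: "m \<in> M \<Longrightarrow> cinner (ortho_proj M x) m = cinner x m"
    and cinner_ortho_proj_right: "m \<in> M \<Longrightarrow> cinner m (ortho_proj M x) = cinner m x"
proof -
  obtain y where y: "y \<in> M" "\<And>m. m \<in> M \<Longrightarrow> cinner (x - y) m = 0"
    using ortho_decomposition_exists[OF M] by metis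
  hence p: "ortho_proj M x = y" using M by (intro ortho_projI) (auto simp: closed_csubspace_def)
  show "ortho_proj M x \<in> M" using p y by simp
  show *: "cinner (ortho_proj M x) m = cinner x m" if "m \<in> M" for m
    using p y(2)[OF that] by (simp add: cinner_diff_left)
  show "cinner m (ortho_proj M x) = cinner m x" if "m \<in> M" for m
    using *[OF that] cinner_commute by metis
qed

lemma ortho_proj_id: "csubspace M \<Longrightarrow> x \<in> M \<Longrightarrow> ortho_proj M (x::'a::complex_inner) = x"
  by (rule ortho_projI) auto

text \<open>A closed subspace is its own second orthogonal complement.\<close>

lemma closed_csubspace_memI:
  fixes M :: "'a::complex_hilbert set"
  assumes M: "closed_csubspace M" and "\<And>y. (\<And>m. m \<in> M \<Longrightarrow> cinner m y = 0) \<Longrightarrow> cinner x y = 0"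
  shows "x \<in> M"
proof -
  let ?y = "x - ortho_proj M x"
  have "cinner m ?y = 0" if "m \<in> M" for m
    using that by (simp add: cinner_diff_right cinner_ortho_proj_right[OF M])
  hence "cinner x ?y = 0" "cinner (ortho_proj M x) ?y = 0"
    using assms(2) ortho_proj_in[OF M] by blast+
  hence "cinner ?y ?y = 0" by (subst cinner_diff_left) simp
  thus ?thesis using ortho_proj_in[OF M, of x] by (simp only: cinner_self_eq_0) simp
qed

text \<open>The coefficients \<open>\<langle>y, T e\<rangle>\<close> of \<open>T\<^sup>*y\<close> in an orthonormal basis are square summable, because testing \<open>y\<close>
  against \<open>T v\<close> for the partial sum \<open>v = \<Sum> \<langle>y, T e\<rangle> e\<close> gives \<open>\<parallel>v\<parallel>\<^sup>2 = \<langle>y, T v\<rangle> \<le> b \<parallel>y\<parallel> \<parallel>v\<parallel>\<close>.\<close>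

lemma adjoint_exists:
  fixes T :: "'a::complex_hilbert \<Rightarrow> 'a"
  assumes T: "operator_on UNIV UNIV T"
  shows "\<exists>R. \<forall>x y. cinner (T x) y = cinner x (R y)"
proof -
  obtain b where b: "\<And>x. norm (T x) \<le> b * norm x"
    and lin: "\<And>x y. T (x + y) = T x + T y" "\<And>c x. T (c *\<^sub>C x) = c *\<^sub>C T x"
    using T unfolding operator_on_def by auto
  have bl: "bounded_linear T"
    using b lin by (intro bounded_linear_intro[where K = b]) (auto simp: scaleR_scaleC mult.commute)
  interpret T: bounded_linear T by fact
  have UN: "closed_csubspace (UNIV::'a set)" by (auto simp: closed_csubspace_def csubspace_def)
  obtain E :: "'a set" where E: "orthonormal_family (\<lambda>e. e) E" "total_in (\<lambda>e. e) E UNIV"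
    using total_orthonormal_subset_exists UN unfolding closed_csubspace_def by blast
  have "\<exists>r. \<forall>x. cinner (T x) y = cinner x r" for y
  proof -
    have bdd: "(\<Sum>i\<in>F. (cmod (cinner y (T i)))\<^sup>2) \<le> (b * norm y)\<^sup>2" if F: "finite F" "F \<subseteq> E" for F
    proof -
      let ?v = "\<Sum>i\<in>F. cinner y (T i) *\<^sub>C i"
      have nv: "(norm ?v)\<^sup>2 = (\<Sum>i\<in>F. (cmod (cinner y (T i)))\<^sup>2)"
        by (rule norm_sum_orthonormal[OF E(1) F])
      have "cinner y (T ?v) = (\<Sum>i\<in>F. cnj (cinner y (T i)) * cinner y (T i))"
        by (simp add: T.sum lin cinner.sum_right cinner_scaleC_right)
      also have "\<dots> = complex_of_real (\<Sum>i\<in>F. (cmod (cinner y (T i)))\<^sup>2)"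
        unfolding of_real_sum complex_norm_square by (simp add: mult.commute)
      finally have "cinner y (T ?v) = complex_of_real ((norm ?v)\<^sup>2)" unfolding nv .
      hence "cmod (cinner y (T ?v)) = (norm ?v)\<^sup>2" by (simp add: norm_power)
      hence "(norm ?v)\<^sup>2 \<le> norm y * (b * norm ?v)"
        using cmod_cinner_le[of y "T ?v"] mult_left_mono[OF b[of ?v], of "norm y"] by simp
      hence "norm ?v \<le> b * norm y \<or> norm ?v = 0"
        by (cases "norm ?v = 0") (auto simp: power2_eq_square mult.assoc mult.commute mult.left_commute)
      thus ?thesis unfolding nv[symmetric] using power_mono[of "norm ?v" "b * norm y" 2] by auto
    qed
    have "\<exists>r. ((\<lambda>i. cinner y (T i) *\<^sub>C i) has_sum r) E \<and> (\<forall>i\<in>E. cinner r i = cinner y (T i)) \<and>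
        ((\<lambda>i. (cmod (cinner y (T i)))\<^sup>2) has_sum (norm r)\<^sup>2) E"
      by (rule riesz_fischer[OF E(1) bdd])
    then obtain r where r: "\<forall>i\<in>E. cinner r i = cinner y (T i)" by (elim exE conjE)
    have "cinner (T x) y = cinner x r" for x
    proof -
      have x: "((\<lambda>i. cinner x i *\<^sub>C i) has_sum x) E" by (rule fourier_expansion(1)[OF E UN]) simp
      have "((\<lambda>i. cinner (T (cinner x i *\<^sub>C i)) y) has_sum cinner (T x) y) E"
        by (intro has_sum_bounded_linear[OF cinner.bounded_linear_left]
            has_sum_bounded_linear[OF bl] x)
      moreover have "((\<lambda>i. cinner (cinner x i *\<^sub>C i) r) has_sum cinner x r) E"
        by (intro has_sum_bounded_linear[OF cinner.bounded_linear_left] x)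
      moreover have "cinner (T (cinner x i *\<^sub>C i)) y = cinner (cinner x i *\<^sub>C i) r" if "i \<in> E" for i
        using bspec[OF r that] cinner_commute[of i r] cinner_commute[of "T i" y]
        by (simp add: lin cinner_scaleC_left)
      ultimately show ?thesis
        using has_sum_unique[where f = "\<lambda>i. cinner (T (cinner x i *\<^sub>C i)) y" and A = E]
        by (simp cong: has_sum_cong)
    qed
    thus ?thesis by blast
  qed
  thus ?thesis by metis
qed

lemma cadjoint_eqI:
  assumes "\<And>x y. cinner (T x) y = cinner x (R y)"
  shows "cadjoint T = (R :: 'a::complex_inner \<Rightarrow> 'a)"
  unfolding cadjoint_def
proof (rule the_equality)
  fix S assume S: "\<forall>x y. cinner (T x) y = cinner x (S y)"
  show "S = R"
  proof
    fix y show "S y = R y"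
      by (rule cinner_eqI) (metis S assms cinner_commute)
  qed
qed (use assms in auto)

lemma cinner_cadjoint:
  fixes T :: "'a::complex_hilbert \<Rightarrow> 'a"
  assumes "operator_on UNIV UNIV T"
  shows "cinner (T x) y = cinner x (cadjoint T y)"
  using adjoint_exists[OF assms] cadjoint_eqI by metis

lemma contraction_cadjoint:
  fixes T :: "'a::complex_hilbert \<Rightarrow> 'a"
  assumes T: "contraction T"
  shows "contraction (cadjoint T)"
proof -
  let ?R = "cadjoint T"
  have adj: "cinner (T x) y = cinner x (?R y)" for x y
    using T by (intro cinner_cadjoint) (simp add: contraction_def)
  have adj': "cinner (?R y) x = cinner y (T x)" for x y
    using adj cinner_commute by metis
  have "norm (?R y) \<le> norm y" for y
  proof -
    have "(norm (?R y))\<^sup>2 = cmod (cinner (?R y) (?R y))" by (simp add: cinner_self norm_power)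
    also have "\<dots> = cmod (cinner y (T (?R y)))" by (simp add: adj')
    also have "\<dots> \<le> norm y * norm (T (?R y))" by (rule cmod_cinner_le)
    also have "\<dots> \<le> norm y * norm (?R y)"
      using T by (intro mult_left_mono) (auto simp: contraction_def)
    finally show ?thesis by (cases "norm (?R y) = 0") (auto simp: power2_eq_square)
  qed
  moreover have "?R (x + y) = ?R x + ?R y" for x y
    by (rule cinner_eqI) (simp add: adj' cinner_add_left)
  moreover have "?R (c *\<^sub>C x) = c *\<^sub>C ?R x" for c x
    by (rule cinner_eqI) (simp add: adj' cinner_scaleC_left)
  ultimately show ?thesis
    unfolding contraction_def operator_on_def by (auto intro!: exI[of _ 1])
qed

section \<open>Positive square roots\<close>

lemma operator_on_bounded_linear:
  fixes A :: "'a::complex_inner \<Rightarrow> 'a"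
  assumes "operator_on UNIV UNIV A"
  shows "bounded_linear A"
proof -
  obtain b where "\<And>x. norm (A x) \<le> b * norm x"
    and "\<And>x y. A (x + y) = A x + A y" "\<And>c x. A (c *\<^sub>C x) = c *\<^sub>C A x"
    using assms unfolding operator_on_def by auto
  thus ?thesis
    by (intro bounded_linear_intro[where K = b]) (auto simp: scaleR_scaleC mult.commute)
qed

lemma operator_on_scaleC: "operator_on UNIV UNIV A \<Longrightarrow> A (c *\<^sub>C x) = c *\<^sub>C A x"
  by (simp add: operator_on_def)

text \<open>Polarization: the form \<open>\<langle>A x, y\<rangle> - \<langle>x, A y\<rangle>\<close> vanishes on the diagonal.\<close>

lemma positive_operator_selfadjoint:
  fixes A :: "'a::complex_inner \<Rightarrow> 'a"
  assumes A: "positive_operator A"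
  shows "cinner (A x) y = cinner x (A y)"
proof -
  have op: "operator_on UNIV UNIV A" and re: "\<And>x. cinner (A x) x \<in> \<real>"
    using A by (auto simp: positive_operator_def)
  interpret A: bounded_linear A by (rule operator_on_bounded_linear[OF op])
  define q where "q x y = cinner (A x) y - cinner x (A y)" for x y
  have diag: "q x x = 0" for x
    using re[of x] cinner_commute[of x "A x"] by (simp add: q_def Reals_cnj_iff)
  have "q x y + q y x = q (x + y) (x + y)" for x y
    using diag[of x] diag[of y]
    by (simp add: q_def A.add cinner_add_left cinner_add_right algebra_simps)
  hence anti: "q x y = - q y x" for x y using diag by (metis eq_neg_iff_add_eq_0)
  have "q x (\<i> *\<^sub>C y) = - \<i> * q x y" "q (\<i> *\<^sub>C y) x = \<i> * q y x"
    by (auto simp: q_def operator_on_scaleC[OF op] cinner_scaleC_left cinner_scaleC_right algebra_simps)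
  hence "q x y = q y x" using anti[of x "\<i> *\<^sub>C y"] by simp
  hence "q x y = 0" using anti[of x y] by simp
  thus ?thesis by (simp add: q_def)
qed

text \<open>Otherwise the quadratic form of \<open>A\<close> would become negative on moving from \<open>y\<close> a little in the
  direction \<open>- A y\<close>.\<close>

lemma positive_operator_eq_0:
  fixes A :: "'a::complex_inner \<Rightarrow> 'a"
  assumes A: "positive_operator A" and 0: "cinner (A y) y = 0"
  shows "A y = 0"
proof -
  have op: "operator_on UNIV UNIV A" and pos: "\<And>x. 0 \<le> Re (cinner (A x) x)"
    using A by (auto simp: positive_operator_def)
  interpret A: bounded_linear A by (rule operator_on_bounded_linear[OF op])
  define p K where "p = (norm (A y))\<^sup>2" and "K = Re (cinner (A (A y)) (A y))"
  have K: "K \<ge> 0" using pos by (simp add: K_def)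
  have q: "0 \<le> t\<^sup>2 * K - 2 * t * p" for t :: real
  proof -
    have "cinner (A (y - t *\<^sub>R A y)) (y - t *\<^sub>R A y) =
        complex_of_real (t\<^sup>2) * cinner (A (A y)) (A y) - complex_of_real (2 * t) * cinner (A y) (A y)"
      using 0 positive_operator_selfadjoint[OF A, of "A y" y]
      by (simp add: A.diff A.scaleR cinner_diff_left cinner_diff_right cinner_scaleR_left
          cinner_scaleR_right scaleR_conv_of_real algebra_simps power2_eq_square)
    hence "Re (cinner (A (y - t *\<^sub>R A y)) (y - t *\<^sub>R A y)) = t\<^sup>2 * K - 2 * t * p"
      by (simp add: K_def p_def cinner_self[of "A y"])
    thus ?thesis using pos[of "y - t *\<^sub>R A y"] by simp
  qed
  have "p = 0"
  proof (rule ccontr)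
    assume "p \<noteq> 0"
    hence p: "p > 0" by (simp add: p_def)
    have "(p / (K + 1))\<^sup>2 * K - 2 * (p / (K + 1)) * p = p\<^sup>2 * (K - 2 * (K + 1)) / (K + 1)\<^sup>2"
      using K by (simp add: field_simps power2_eq_square add_nonneg_eq_0_iff)
    also have "\<dots> < 0" using K p by (intro divide_neg_pos mult_pos_neg) auto
    finally show False using q[of "p / (K + 1)"] by simp
  qed
  thus ?thesis by (simp add: p_def)
qed

text \<open>The Taylor coefficients of \<open>sqrt (1 - x)\<close> at \<open>0\<close>.\<close>

definition sqrt_coeff :: "nat \<Rightarrow> real" where
  "sqrt_coeff k = (-1) ^ k * ((1/2) gchoose k)"

lemma sqrt_coeff_0 [simp]: "sqrt_coeff 0 = 1"
  by (simp add: sqrt_coeff_def)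

lemma sqrt_coeff_nonpos: "sqrt_coeff (Suc k) \<le> 0"
proof -
  have "sqrt_coeff (Suc k) = pochhammer (-1/2) (Suc k) / fact (Suc k)"
    by (simp add: sqrt_coeff_def gbinomial_pochhammer flip: power_add mult.assoc mult_2)
  also have "\<dots> \<le> 0"
    by (simp add: pochhammer_rec divide_nonpos_pos pochhammer_nonneg)
  finally show ?thesis .
qed

text \<open>The alternating sum telescopes to \<open>(-1)\<^sup>n\<close> times the binomial coefficient of \<open>-1/2\<close>. As all
  coefficients but the first are nonpositive, their absolute values then sum to at most \<open>1\<close>.\<close>

lemma sum_sqrt_coeff_nonneg: "(\<Sum>k\<le>n. sqrt_coeff k) \<ge> 0"
proof -
  have "(\<Sum>k\<le>n. sqrt_coeff k) = (-1) ^ n * ((1/2 - 1) gchoose n)"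
    unfolding gbinomial_sum_lower_neg[symmetric] by (simp add: sqrt_coeff_def mult.commute)
  also have "\<dots> = pochhammer (1/2) n / fact n"
    by (simp add: gbinomial_pochhammer flip: power_add mult.assoc mult_2)
  also have "\<dots> \<ge> 0" by (simp add: pochhammer_nonneg)
  finally show ?thesis .
qed

lemma sum_abs_sqrt_coeff: "(\<Sum>k\<in>{1..n}. \<bar>sqrt_coeff k\<bar>) \<le> 1"
proof -
  have "(\<Sum>k\<in>{1..n}. \<bar>sqrt_coeff k\<bar>) = - (\<Sum>k\<in>{1..n}. sqrt_coeff k)"
    unfolding sum_negf[symmetric]
  proof (intro sum.cong refl)
    fix k assume "k \<in> {1..n}"
    thus "\<bar>sqrt_coeff k\<bar> = - sqrt_coeff k" using sqrt_coeff_nonpos[of "k - 1"] by simp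
  qed
  moreover have "(\<Sum>k\<le>n. sqrt_coeff k) = 1 + (\<Sum>k\<in>{1..n}. sqrt_coeff k)"
    by (simp add: atMost_atLeast0 sum.atLeast_Suc_atMost)
  ultimately show ?thesis using sum_sqrt_coeff_nonneg[of n] by linarith
qed

text \<open>The square of the series is \<open>1 - x\<close>, by Vandermonde's identity for \<open>1/2 + 1/2\<close>.\<close>

lemma sqrt_coeff_convolution:
  "(\<Sum>i\<le>n. sqrt_coeff i * sqrt_coeff (n - i)) = (if n = 0 then 1 else if n = 1 then -1 else 0)"
proof -
  have "(\<Sum>i\<le>n. sqrt_coeff i * sqrt_coeff (n - i)) =
      (\<Sum>i\<le>n. (-1) ^ n * (((1/2) gchoose i) * ((1/2) gchoose (n - i))))"
    by (intro sum.cong refl) (auto simp: sqrt_coeff_def simp flip: power_add)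
  also have "\<dots> = (-1) ^ n * ((1/2 + 1/2 :: real) gchoose n)"
    by (simp add: gbinomial_Vandermonde atMost_atLeast0 flip: sum_distrib_left)
  also have "(1/2 + 1/2 :: real) gchoose n = of_nat (1 choose n)"
    by (simp add: binomial_gbinomial)
  also have "(-1) ^ n * (of_nat (1 choose n) :: real) =
      (if n = 0 then 1 else if n = 1 then -1 else 0)"
    by (cases n; cases "n - 1") auto
  finally show ?thesis .
qed

lemma abs_sqrt_coeff_summable: "(\<lambda>k. \<bar>sqrt_coeff k\<bar>) summable_on UNIV"
proof (rule nonneg_bdd_above_summable_on)
  have "sum (\<lambda>k. \<bar>sqrt_coeff k\<bar>) F \<le> 2" if F: "finite F" for F
  proof -
    have "sum (\<lambda>k. \<bar>sqrt_coeff k\<bar>) F \<le> sum (\<lambda>k. \<bar>sqrt_coeff k\<bar>) (insert 0 {1..Max F})"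
      using F by (intro sum_mono2) (auto simp: Suc_le_eq)
    also have "\<dots> = 1 + (\<Sum>k\<in>{1..Max F}. \<bar>sqrt_coeff k\<bar>)" by simp
    finally show ?thesis using sum_abs_sqrt_coeff[of "Max F"] by linarith
  qed
  thus "bdd_above (sum (\<lambda>k. \<bar>sqrt_coeff k\<bar>) ` {F. F \<subseteq> UNIV \<and> finite F})"
    by (auto intro!: bdd_aboveI)
qed auto

text \<open>
  Since the coefficients of \<open>sqrt (1 - x)\<close> are absolutely summable, the binomial series
  converges for every contraction \<open>X\<close>, and \<open>\<Sum>k\<ge>1. \<bar>sqrt_coeff k\<bar> \<le> 1\<close> makes its sum positive when
  \<open>X\<close> is. As a limit of polynomials in \<open>X\<close>, the sum commutes with whatever commutes with \<open>X\<close>; this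
  is what uniqueness needs.
\<close>

lemma positive_sqrt_exists:
  fixes X :: "'a::complex_hilbert \<Rightarrow> 'a"
  assumes pos: "positive_operator X" and le: "\<And>x. norm (X x) \<le> norm x"
  shows "\<exists>B. positive_operator B \<and> B \<circ> B = (\<lambda>x. x - X x) \<and>
    (\<forall>C. bounded_linear C \<and> (\<forall>x. C (X x) = X (C x)) \<longrightarrow> (\<forall>x. C (B x) = B (C x)))"
proof -
  let ?a = sqrt_coeff
  have op: "operator_on UNIV UNIV X" using pos by (simp add: positive_operator_def)
  have pbl: "bounded_linear (X ^^ k)" for k
    by (induction k) (auto simp: o_def id_def bounded_linear_ident
        intro: bounded_linear_compose[OF operator_on_bounded_linear[OF op]])
  have ple: "norm ((X ^^ k) x) \<le> norm x" for k x
    by (induction k) (auto intro: order_trans[OF le])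
  have pC: "(X ^^ k) (c *\<^sub>C x) = c *\<^sub>C (X ^^ k) x" for k c x
    by (induction k) (auto simp: operator_on_scaleC[OF op])
  have psa: "cinner ((X ^^ k) x) y = cinner x ((X ^^ k) y)" for k x y
    by (induction k arbitrary: x y)
      (auto simp: positive_operator_selfadjoint[OF pos] funpow_swap1)
  have ppos: "0 \<le> Re (cinner ((X ^^ k) x) x) \<and> cinner ((X ^^ k) x) x \<in> \<real>" for k x
  proof -
    have "\<exists>j. k = j + j \<or> k = j + Suc j" by presburger
    then obtain j where "k = j + j \<or> k = j + Suc j" by blast
    hence "cinner ((X ^^ k) x) x = cinner ((X ^^ j) x) ((X ^^ j) x) \<or>
        cinner ((X ^^ k) x) x = cinner (X ((X ^^ j) x)) ((X ^^ j) x)"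
      unfolding psa[symmetric] by (auto simp: funpow_add simp flip: funpow_swap1)
    thus ?thesis using pos by (auto simp: positive_operator_def cinner_self)
  qed
  have asumm: "(\<lambda>k. \<bar>?a k\<bar> * norm x) summable_on UNIV" for x :: 'a
    by (intro summable_on_cmult_left abs_sqrt_coeff_summable)
  have nsumm: "(\<lambda>k. norm (?a k *\<^sub>R (X ^^ k) x)) summable_on UNIV" for x
    by (rule Infinite_Sum.abs_summable_on_comparison_test'[OF asumm[of x]])
      (auto intro: mult_left_mono ple)
  have summ: "(\<lambda>k. ?a k *\<^sub>R (X ^^ k) x) summable_on UNIV" for x
    by (rule Infinite_Sum.abs_summable_summable[OF nsumm])
  define B where "B x = infsum (\<lambda>k. ?a k *\<^sub>R (X ^^ k) x) UNIV" for x
  have B: "((\<lambda>k. ?a k *\<^sub>R (X ^^ k) x) has_sum B x) UNIV" for x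
    using summ by (simp add: B_def)
  have Badd: "B (x + y) = B x + B y" for x y
    using has_sum_add[OF B[of x] B[of y]] B[of "x + y"]
    by (simp add: linear_simps(1)[OF pbl] scaleR_add_right has_sum_unique)
  have BC: "B (c *\<^sub>C x) = c *\<^sub>C B x" for c x
    using has_sum_bounded_linear[OF bounded_linear_scaleC B, of c x] B[of "c *\<^sub>C x"]
    by (simp add: pC linear_simps(5)[OF bounded_linear_scaleC, symmetric] has_sum_unique)
  have Ble: "norm (B x) \<le> infsum (\<lambda>k. \<bar>?a k\<bar>) UNIV * norm x" for x
  proof -
    have "norm (B x) \<le> infsum (\<lambda>k. norm (?a k *\<^sub>R (X ^^ k) x)) UNIV"
      by (rule norm_has_sum_bound[OF has_sum_infsum[OF nsumm] B])
    also have "\<dots> \<le> infsum (\<lambda>k. \<bar>?a k\<bar> * norm x) UNIV"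
      by (intro infsum_mono nsumm asumm) (auto intro: mult_left_mono ple)
    also have "\<dots> = infsum (\<lambda>k. \<bar>?a k\<bar>) UNIV * norm x"
      by (intro infsum_cmult_left abs_sqrt_coeff_summable)
    finally show ?thesis .
  qed
  have Bop: "operator_on UNIV UNIV B"
    unfolding operator_on_def using Badd BC Ble by blast
  have Bpos: "cinner (B x) x \<in> \<real> \<and> 0 \<le> Re (cinner (B x) x)" for x
  proof -
    have s: "((\<lambda>k. cinner (?a k *\<^sub>R (X ^^ k) x) x) has_sum cinner (B x) x) UNIV"
      by (intro has_sum_bounded_linear[OF cinner.bounded_linear_left] B)
    have s': "(\<lambda>n. \<Sum>k\<le>n. cinner (?a k *\<^sub>R (X ^^ k) x) x) \<longlonglongrightarrow> cinner (B x) x"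
      using has_sum_imp_sums[OF s] by (simp add: sums_def_le)
    have *: "(\<Sum>k\<le>n. cinner (?a k *\<^sub>R (X ^^ k) x) x) \<in> {z. z \<in> \<real> \<and> 0 \<le> Re z}" for n
    proof -
      have "(norm x)\<^sup>2 * (\<Sum>k\<le>n. ?a k) \<le> (\<Sum>k\<le>n. ?a k * Re (cinner ((X ^^ k) x) x))"
        unfolding sum_distrib_left
      proof (intro sum_mono)
        fix k
        have "Re (cinner ((X ^^ k) x) x) \<le> norm ((X ^^ k) x) * norm x"
          using cmod_cinner_le complex_Re_le_cmod order_trans by blast
        also have "\<dots> \<le> norm x * norm x" by (intro mult_right_mono ple) auto
        finally have "Re (cinner ((X ^^ k) x) x) \<le> (norm x)\<^sup>2" by (simp add: power2_eq_square)
        thus "(norm x)\<^sup>2 * ?a k \<le> ?a k * Re (cinner ((X ^^ k) x) x)"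
          using sqrt_coeff_nonpos[of "k - 1"]
          by (cases k) (auto simp: cinner_self mult.commute[of "(norm x)\<^sup>2"] intro: mult_left_mono_neg)
      qed
      hence "0 \<le> (\<Sum>k\<le>n. ?a k * Re (cinner ((X ^^ k) x) x))"
        using sum_sqrt_coeff_nonneg[of n] by (meson mult_nonneg_nonneg order_trans zero_le_power2)
      thus ?thesis
        using ppos by (auto simp: cinner_scaleR_left scaleR_conv_of_real intro!: Reals_mult sum_in_Reals)
    qed
    have "closed {z. z \<in> \<real> \<and> 0 \<le> Re z}"
      by (intro closed_Collect_conj closed_Collect_le continuous_intros)
         (simp_all add: closed_complex_Reals)
    from closed_sequentially[OF this _ s'] * show ?thesis by auto
  qed
  have BB: "B (B x) = x - X x" for x
  proof -
    \<comment> \<open>The double series of \<open>B (B x)\<close> is absolutely summable; its rows give \<open>B (B x)\<close>, and its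
      antidiagonals \<open>i + j = n\<close> give \<open>x - X x\<close> by the convolution identity.\<close>
    define F where "F = (\<lambda>(i, j). (?a i * ?a j) *\<^sub>R (X ^^ (i + j)) x)"
    have "(\<lambda>(i, j). \<bar>?a i\<bar> * (\<bar>?a j\<bar> * norm x)) summable_on UNIV \<times> UNIV"
      by (rule summable_on_SigmaI[where g = "\<lambda>i. \<bar>?a i\<bar> * (infsum (\<lambda>j. \<bar>?a j\<bar>) UNIV * norm x)"])
        (auto intro!: has_sum_cmult_right has_sum_cmult_left has_sum_infsum summable_on_cmult_left
          abs_sqrt_coeff_summable)
    hence "(\<lambda>p. norm (F p)) summable_on UNIV \<times> UNIV"
      by (rule Infinite_Sum.abs_summable_on_comparison_test')
        (auto simp: F_def abs_mult mult.assoc intro!: mult_left_mono ple)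
    then obtain s where s: "(F has_sum s) (UNIV \<times> UNIV)"
      using Infinite_Sum.abs_summable_summable summable_on_def by blast
    have "((\<lambda>i. ?a i *\<^sub>R (X ^^ i) (B x)) has_sum s) UNIV"
    proof (rule has_sum_SigmaD[OF s])
      fix i
      have "((\<lambda>j. ?a i *\<^sub>R (X ^^ i) (?a j *\<^sub>R (X ^^ j) x)) has_sum ?a i *\<^sub>R (X ^^ i) (B x)) UNIV"
        by (intro has_sum_bounded_linear[OF bounded_linear_scaleR_right]
            has_sum_bounded_linear[OF pbl] B)
      thus "((\<lambda>j. F (i, j)) has_sum ?a i *\<^sub>R (X ^^ i) (B x)) UNIV"
        by (simp add: F_def linear_simps(5)[OF pbl] funpow_add)
    qed
    hence sB: "s = B (B x)" using B has_sum_unique by blast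
    have "((\<lambda>p. F (case p of (n, i) \<Rightarrow> (i, n - i))) has_sum s) (SIGMA n:UNIV. {..n})"
    proof -
      have bij: "bij_betw (\<lambda>(n, i). (i, n - i)) (SIGMA n:UNIV. {..n}) (UNIV \<times> UNIV :: (nat \<times> nat) set)"
        by (rule bij_betw_byWitness[where f' = "\<lambda>(i, j). (i + j, i)"]) auto
      show ?thesis by (rule iffD2[OF has_sum_reindex_bij_betw[OF bij] s])
    qed
    hence "((\<lambda>n. \<Sum>i\<le>n. F (i, n - i)) has_sum s) UNIV"
      by (rule has_sum_SigmaD) (auto intro!: has_sum_finiteI)
    moreover have "(\<Sum>i\<le>n. F (i, n - i)) = (if n = 0 then x else if n = 1 then - X x else 0)" for n
    proof -
      have "(\<Sum>i\<le>n. F (i, n - i)) = (\<Sum>i\<le>n. ?a i * ?a (n - i)) *\<^sub>R (X ^^ n) x"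
        unfolding scaleR_sum_left F_def by (intro sum.cong) auto
      thus ?thesis unfolding sqrt_coeff_convolution by simp
    qed
    ultimately have "((\<lambda>n::nat. if n = 0 then x else if n = 1 then - X x else 0) has_sum s) UNIV"
      by simp
    moreover have "((\<lambda>n::nat. if n = 0 then x else if n = 1 then - X x else 0) has_sum (x - X x)) UNIV"
      by (rule has_sum_finite_neutralI[of "{0, 1}"]) auto
    ultimately show ?thesis using sB has_sum_unique by blast
  qed
  have comm: "C (B x) = B (C x)" if C: "bounded_linear C" "\<And>x. C (X x) = X (C x)" for C x
  proof -
    have "C ((X ^^ k) x) = (X ^^ k) (C x)" for k by (induction k) (auto simp: C)
    hence "((\<lambda>k. ?a k *\<^sub>R (X ^^ k) (C x)) has_sum C (B x)) UNIV"
      using has_sum_bounded_linear[OF C(1) B[of x]] by (simp add: linear_simps(5)[OF C(1)])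
    thus ?thesis using B has_sum_unique by blast
  qed
  show ?thesis
  proof (intro exI[of _ B] conjI allI impI)
    show "positive_operator B" using Bop Bpos by (simp add: positive_operator_def)
    show "B \<circ> B = (\<lambda>x. x - X x)" using BB by (simp add: fun_eq_iff)
  qed (use comm in blast)
qed

text \<open>For a second positive root \<open>C\<close>, which commutes with \<open>X\<close> and hence with \<open>B\<close>, put \<open>y = B x - C x\<close>. Then
  \<open>(B + C) y = 0\<close>, so both \<open>B y\<close> and \<open>C y\<close> vanish by positivity, and
  \<open>\<parallel>y\<parallel>\<^sup>2 = \<langle>x, (B - C) y\<rangle> = 0\<close>.\<close>

lemma positive_sqrt:
  fixes X :: "'a::complex_hilbert \<Rightarrow> 'a"
  assumes pos: "positive_operator X" and le: "\<And>x. norm (X x) \<le> norm x"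
  defines "D \<equiv> positive_sqrt (\<lambda>x. x - X x)"
  shows "positive_operator D" "D (D x) = x - X x"
proof -
  obtain B where B: "positive_operator B" "B \<circ> B = (\<lambda>x. x - X x)"
    and comm: "\<forall>C. bounded_linear C \<and> (\<forall>x. C (X x) = X (C x)) \<longrightarrow> (\<forall>x. C (B x) = B (C x))"
    using positive_sqrt_exists[OF pos le] by (elim exE conjE)
  have uniq: "C = B" if C: "positive_operator C" "C \<circ> C = (\<lambda>x. x - X x)" for C
  proof
    fix x
    interpret C: bounded_linear C
      using C(1) by (intro operator_on_bounded_linear) (simp add: positive_operator_def)
    interpret B: bounded_linear B
      using B(1) by (intro operator_on_bounded_linear) (simp add: positive_operator_def)
    have CC: "C (C y) = y - X y" for y using C(2) by (metis comp_apply)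
    have BB: "B (B y) = y - X y" for y using B(2) by (metis comp_apply)
    have CX: "C (X y) = X (C y)" for y
      using CC[of y] CC[of "C y"] C.diff[of y "X y"] by simp
    have CB: "C (B y) = B (C y)" for y using comm C.bounded_linear_axioms CX by simp
    define y where "y = B x - C x"
    have "B y + C y = 0" by (simp add: y_def B.diff C.diff BB CC CB)
    hence sum0: "cinner (B y) y + cinner (C y) y = 0" by (simp flip: cinner_add_left)
    have p: "cinner (B y) y \<in> \<real>" "0 \<le> Re (cinner (B y) y)" "cinner (C y) y \<in> \<real>" "0 \<le> Re (cinner (C y) y)"
      using B(1) C(1) by (auto simp: positive_operator_def)
    have "cinner (B y) y = 0" "cinner (C y) y = 0"
      using sum0 p by (auto simp: complex_eq_iff complex_is_Real_iff)
    hence "B y = 0" "C y = 0" using positive_operator_eq_0 B(1) C(1) by blast+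
    moreover have "cinner y y = cinner x (B y) - cinner x (C y)"
      by (subst (1) y_def) (simp add: cinner_diff_left positive_operator_selfadjoint[OF B(1)]
          positive_operator_selfadjoint[OF C(1)])
    ultimately have "y = 0" by simp
    thus "C x = B x" by (simp add: y_def)
  qed
  have D: "D = B" unfolding D_def positive_sqrt_def
  proof (rule the_equality)
    show "positive_operator B \<and> B \<circ> B = (\<lambda>x. x - X x)" using B by blast
  qed (use uniq in blast)
  show "positive_operator D" using B(1) unfolding D .
  show "D (D x) = x - X x" using fun_cong[OF B(2), of x] unfolding D by simp
qed

lemma defect_op:
  fixes T :: "'a::complex_hilbert \<Rightarrow> 'a"
  assumes T: "contraction T"
  shows positive_operator_defect_op: "positive_operator (defect_op T)"
    and defect_op_defect_op: "defect_op T (defect_op T x) = x - cadjoint T (T x)"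
proof -
  let ?R = "cadjoint T"
  have opT: "operator_on UNIV UNIV T" and leT: "\<And>x. norm (T x) \<le> norm x"
    using T by (auto simp: contraction_def)
  have opR: "operator_on UNIV UNIV ?R" and leR: "\<And>x. norm (?R x) \<le> norm x"
    using contraction_cadjoint[OF T] by (auto simp: contraction_def)
  have le: "norm (?R (T x)) \<le> norm x" for x using order_trans[OF leR leT] .
  have "cinner (?R (T x)) x = cinner (T x) (T x)" for x
    using cinner_cadjoint[OF opT, of x "T x"] by (metis cinner_commute)
  moreover have "operator_on UNIV UNIV (\<lambda>x. ?R (T x))"
    using opT opR le unfolding operator_on_def by (auto intro!: exI[of _ 1])
  ultimately have "positive_operator (\<lambda>x. ?R (T x))"
    by (simp add: positive_operator_def cinner_self)
  from positive_sqrt[OF this le] show "positive_operator (defect_op T)"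
    "defect_op T (defect_op T x) = x - ?R (T x)" by (auto simp: defect_op_def)
qed

section \<open>Polynomial characteristic functions\<close>

text \<open>Applied below to the scalar functions \<open>\<langle>\<Theta>\<^sub>T(z) x, v\<rangle>\<close>, whose Taylor series comes from the Neumann
  series of \<open>(I - z T\<^sup>*)\<^sup>-\<^sup>1\<close>.\<close>

lemma power_series_unique:
  fixes c d :: "nat \<Rightarrow> complex"
  assumes c: "\<And>z. norm z < 1 \<Longrightarrow> (\<lambda>k. c k * z ^ k) sums s z"
    and d: "\<And>z. norm z < 1 \<Longrightarrow> (\<lambda>k. d k * z ^ k) sums s z"
  shows "c = d"
proof -
  have radius: "fps_conv_radius (Abs_fps a) > 0"
    if "\<And>z. norm z < 1 \<Longrightarrow> (\<lambda>k. a k * z ^ k) sums s z" for a :: "nat \<Rightarrow> complex"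
  proof -
    have "summable (\<lambda>k. a k * (1/2) ^ k)" using that[of "1/2"] by (simp add: sums_iff)
    hence "conv_radius a \<ge> norm (1/2 :: complex)" by (rule conv_radius_geI)
    thus ?thesis by (simp add: fps_conv_radius_def) (metis ereal_less(2) half_gt_zero less_le_trans zero_less_one)
  qed
  have "\<forall>\<^sub>F z in nhds 0. z \<in> ball (0::complex) 1" by (intro eventually_nhds_in_open) auto
  hence "\<forall>\<^sub>F z in nhds 0. eval_fps (Abs_fps c) z = eval_fps (Abs_fps d) z"
    by eventually_elim (use c d in \<open>simp add: eval_fps_def sums_iff\<close>)
  hence "Abs_fps c = Abs_fps d" using radius c d by (intro eval_fps_eqD) auto
  thus ?thesis by (auto simp: fps_eq_iff)
qed

lemma neumann_series:
  fixes R :: "'a::complex_hilbert \<Rightarrow> 'a"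
  assumes R: "contraction R" and z: "norm z < 1"
  shows "(\<lambda>k. z ^ k *\<^sub>C (R ^^ k) w) sums inv (\<lambda>y. y - z *\<^sub>C R y) w"
proof -
  let ?f = "\<lambda>k. z ^ k *\<^sub>C (R ^^ k) w"
  have op: "operator_on UNIV UNIV R" and le: "\<And>x. norm (R x) \<le> norm x"
    using R by (auto simp: contraction_def)
  interpret R: bounded_linear R by (rule operator_on_bounded_linear[OF op])
  interpret z: bounded_linear "\<lambda>x::'a. z *\<^sub>C x" by (rule bounded_linear_scaleC)
  have ple: "norm ((R ^^ k) w) \<le> norm w" for k
    by (induction k) (auto intro: order_trans[OF le])
  have "summable ?f"
  proof (rule summable_comparison_test')
    show "summable (\<lambda>k. norm z ^ k * norm w)" using z by (intro summable_mult2 summable_geometric) simp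
    show "norm (?f k) \<le> norm z ^ k * norm w" for k
      by (simp add: norm_power mult_left_mono ple)
  qed
  then obtain y where y: "?f sums y" by (auto simp: summable_def)
  hence "(\<lambda>k. z *\<^sub>C R (?f k)) sums (z *\<^sub>C R y)"
    by (intro bounded_linear.sums[OF bounded_linear_scaleC] R.sums)
  moreover have "z *\<^sub>C R (?f k) = ?f (Suc k)" for k
    by (simp add: operator_on_scaleC[OF op] scaleC_scaleC)
  moreover have "(\<lambda>k. ?f (Suc k)) sums (y - w)"
    using y by (subst sums_Suc_iff) (simp add: scaleC_one)
  ultimately have "z *\<^sub>C R y = y - w" using sums_unique2 by simp
  hence fy: "y - z *\<^sub>C R y = w" by simp
  have "inj (\<lambda>y. y - z *\<^sub>C R y)"
  proof (rule injI)
    fix u v assume "u - z *\<^sub>C R u = v - z *\<^sub>C R v"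
    hence "u - v = z *\<^sub>C R (u - v)" by (simp add: R.diff scaleC_diff_right algebra_simps)
    hence "norm (u - v) = norm z * norm (R (u - v))" by (metis norm_scaleC)
    also have "\<dots> \<le> norm z * norm (u - v)" by (intro mult_left_mono le) auto
    finally have "norm (u - v) \<le> norm z * norm (u - v)" .
    hence "(1 - norm z) * norm (u - v) \<le> 0" unfolding left_diff_distrib by linarith
    hence "norm (u - v) = 0" using z by (auto simp: mult_le_0_iff)
    thus "u = v" by simp
  qed
  from inv_f_f[OF this, of y] show ?thesis using y by (simp add: fy)
qed

text \<open>
  The Taylor coefficient of \<open>\<Theta>\<^sub>T\<close> of order \<open>k + 1\<close> is \<open>D\<^sub>T\<^sub>* T\<^sup>*\<^sup>k D\<^sub>T\<close>, so a polynomial of degree \<open>n\<close>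
  makes it vanish for \<open>k \<ge> n\<close>.
\<close>

lemma char_fun_polynomial_coefficient:
  fixes T :: "'a::complex_hilbert \<Rightarrow> 'a"
  assumes T: "contraction T" and poly: "char_fun_polynomial T n" and k: "n \<le> k"
    and x: "x \<in> defect_space T"
  shows "defect_op (cadjoint T) ((cadjoint T ^^ k) (defect_op T x)) = 0"
proof (rule cinner_eqI)
  fix v
  let ?R = "cadjoint T" and ?D = "defect_op T" and ?E = "defect_op (cadjoint T)"
  have R: "contraction ?R" by (rule contraction_cadjoint[OF T])
  have opE: "operator_on UNIV UNIV ?E"
    using positive_operator_defect_op[OF R] by (simp add: positive_operator_def)
  obtain A where A: "\<And>z. norm z < 1 \<Longrightarrow> char_fun T z x = (\<Sum>k\<le>n. z ^ k *\<^sub>C A k x)"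
    using poly x unfolding char_fun_polynomial_def operator_polynomial_def by auto
  define c where "c k = (case k of 0 \<Rightarrow> - cinner (T x) v | Suc j \<Rightarrow> cinner (?E ((?R ^^ j) (?D x))) v)" for k
  define d where "d k = (if k \<le> n then cinner (A k x) v else 0)" for k
  have "c = d"
  proof (rule power_series_unique)
    fix z :: complex assume z: "norm z < 1"
    let ?y = "inv (\<lambda>y. y - z *\<^sub>C ?R y) (?D x)"
    have "(\<lambda>k. cinner (?E (z ^ k *\<^sub>C (?R ^^ k) (?D x))) v) sums cinner (?E ?y) v"
      by (intro bounded_linear.sums[OF cinner.bounded_linear_left]
          bounded_linear.sums[OF operator_on_bounded_linear[OF opE]] neumann_series R z)
    hence "(\<lambda>k. z * (z ^ k * cinner (?E ((?R ^^ k) (?D x))) v)) sums (z * cinner (?E ?y) v)"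
      by (intro sums_mult) (simp add: operator_on_scaleC[OF opE] cinner_scaleC_left)
    hence "(\<lambda>k. c (Suc k) * z ^ Suc k) sums (z * cinner (?E ?y) v)"
      by (simp add: c_def mult_ac)
    hence "(\<lambda>k. c k * z ^ k) sums (z * cinner (?E ?y) v + c 0 * z ^ 0)" by (subst (asm) sums_Suc_iff) simp
    thus "(\<lambda>k. c k * z ^ k) sums cinner (char_fun T z x) v"
      by (simp add: char_fun_def c_def cinner_add_left cinner_diff_left cinner_scaleC_left add.commute)
    have "(\<lambda>k. if k \<in> {..n} then cinner (A k x) v * z ^ k else 0) sums (\<Sum>k\<le>n. cinner (A k x) v * z ^ k)"
      by (rule sums_If_finite_set) simp
    moreover have "(\<Sum>k\<le>n. cinner (A k x) v * z ^ k) = cinner (char_fun T z x) v"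
      by (simp add: A[OF z] cinner.sum_left cinner_scaleC_left mult.commute)
    moreover have "(\<lambda>k. if k \<in> {..n} then cinner (A k x) v * z ^ k else 0) = (\<lambda>k. d k * z ^ k)"
      by (auto simp: d_def fun_eq_iff)
    ultimately show "(\<lambda>k. d k * z ^ k) sums cinner (char_fun T z x) v" by simp
  qed
  hence "c (Suc k) = 0" using k by (simp add: d_def)
  thus "cinner (?E ((?R ^^ k) (?D x))) v = cinner 0 v" by (simp add: c_def)
qed

lemma cinner_funpow_adjoint:
  fixes T R :: "'a::complex_inner \<Rightarrow> 'a"
  assumes "\<And>x y. cinner (T x) y = cinner x (R y)"
  shows "cinner ((T ^^ k) x) y = cinner x ((R ^^ k) y)"
proof (induction k arbitrary: y)
  case (Suc k)
  have "cinner ((T ^^ Suc k) x) y = cinner x ((R ^^ k) (R y))" by (simp add: assms Suc)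
  thus ?case by (simp only: funpow_Suc_right o_apply)
qed simp

text \<open>
  For \<open>z = T\<^sup>k D\<^sub>T\<^sub>* w\<close>, the vanishing coefficient applied to \<open>D\<^sub>T z\<close> gives
  \<open>\<parallel>D\<^sub>T z\<parallel>\<^sup>2 = \<langle>w, D\<^sub>T\<^sub>* T\<^sup>*\<^sup>k D\<^sub>T (D\<^sub>T z)\<rangle> = 0\<close>. So from the \<open>n\<close>-th step on, the orbits of the vectors of
  \<open>\<D>\<^sub>T\<^sub>*\<close> stay in the kernel of \<open>D\<^sub>T\<close>. The second part, the adjoint of the first, is the same for
  \<open>T\<^sup>*\<close>.
\<close>

lemma char_fun_polynomial_defect:
  fixes T :: "'a::complex_hilbert \<Rightarrow> 'a"
  assumes T: "contraction T" and poly: "char_fun_polynomial T n" and k: "n \<le> k"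
  shows "defect_op T ((T ^^ k) (defect_op (cadjoint T) w)) = 0"
    and "defect_op (cadjoint T) ((cadjoint T ^^ k) (defect_op T w)) = 0"
proof -
  let ?R = "cadjoint T" and ?D = "defect_op T" and ?E = "defect_op (cadjoint T)"
  have R: "contraction ?R" by (rule contraction_cadjoint[OF T])
  have opT: "operator_on UNIV UNIV T" using T by (simp add: contraction_def)
  have adj: "cinner ((T ^^ k) x) y = cinner x ((?R ^^ k) y)" for x y
    by (rule cinner_funpow_adjoint) (rule cinner_cadjoint[OF opT])
  have saD: "cinner (?D x) y = cinner x (?D y)" and saE: "cinner (?E x) y = cinner x (?E y)" for x y
    by (rule positive_operator_selfadjoint positive_operator_defect_op T R)+
  have DTE: "?D ((T ^^ k) (?E w)) = 0" for w
  proof -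
    let ?z = "(T ^^ k) (?E w)"
    have "?D ?z \<in> defect_space T"
      unfolding defect_space_def by (rule subsetD[OF closure_subset rangeI])
    hence "?E ((?R ^^ k) (?D (?D ?z))) = 0" by (rule char_fun_polynomial_coefficient[OF T poly k])
    hence "cinner (?D ?z) (?D ?z) = 0" by (simp add: saD adj saE)
    thus ?thesis by simp
  qed
  show "?D ((T ^^ k) (?E w)) = 0" by (rule DTE)
  show "?E ((?R ^^ k) (?D w)) = 0"
  proof (rule cinner_eqI)
    fix u
    have "cinner u (?E ((?R ^^ k) (?D w))) = cinner (?D ((T ^^ k) (?E u))) w"
      by (simp add: saE saD adj)
    thus "cinner (?E ((?R ^^ k) (?D w))) u = cinner 0 u"
      using cinner_commute[of u] by (simp add: DTE)
  qed
qed

section \<open>Completely non unitary contractions and their isometric parts\<close>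

definition isometric_part :: "('a::complex_inner \<Rightarrow> 'a) \<Rightarrow> 'a set" where
  "isometric_part T = {h. \<forall>k. norm ((T ^^ (k + 1)) h) = norm ((T ^^ k) h)}"

text \<open>
  \<open>T\<close> and its adjoint \<open>R\<close> enter symmetrically, so that every fact about \<open>T\<close> is also one about
  \<open>T\<^sup>*\<close>. The last assumption says in this symmetric form that \<open>T\<close> is completely non unitary: the
  subspaces \<open>M\<close> in it are the reducing ones on which \<open>T\<close> is unitary with inverse \<open>R\<close>.
\<close>

locale cnu_adjoint_pair =
  fixes T R :: "'a::complex_hilbert \<Rightarrow> 'a"
  assumes contraction_T: "contraction T" and contraction_R: "contraction R"
    and adj: "cinner (T x) y = cinner x (R y)"
    and no_unitary_part: "closed_csubspace M \<Longrightarrow>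
      (\<And>x. x \<in> M \<Longrightarrow> T x \<in> M \<and> R x \<in> M \<and> R (T x) = x \<and> T (R x) = x) \<Longrightarrow> M = {0}"
begin

lemma adj': "cinner (R x) y = cinner x (T y)"
  by (metis adj cinner_commute)

lemma dual: "cnu_adjoint_pair R T"
proof
  fix M :: "'a set"
  assume "closed_csubspace M"
    and "\<And>x. x \<in> M \<Longrightarrow> R x \<in> M \<and> T x \<in> M \<and> T (R x) = x \<and> R (T x) = x"
  thus "M = {0}" using no_unitary_part[of M] by simp
qed (rule contraction_T contraction_R adj')+

lemma norm_T_le: "norm (T x) \<le> norm x"
  using contraction_T by (simp add: contraction_def)

lemma bounded_linear_T: "bounded_linear T"
  using contraction_T by (intro operator_on_bounded_linear) (simp add: contraction_def)

lemma T_scaleC: "T (c *\<^sub>C x) = c *\<^sub>C T x"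
  using contraction_T by (intro operator_on_scaleC) (simp add: contraction_def)

lemma bounded_linear_T_pow: "bounded_linear (T ^^ k)"
  by (induction k) (auto simp: o_def id_def bounded_linear_ident
      intro: bounded_linear_compose[OF bounded_linear_T])

lemma T_pow_scaleC: "(T ^^ k) (c *\<^sub>C x) = c *\<^sub>C (T ^^ k) x"
  by (induction k) (auto simp: T_scaleC)

lemma norm_T_pow_le: "norm ((T ^^ k) x) \<le> norm x"
  by (induction k) (auto intro: order_trans[OF norm_T_le])

lemma adj_pow: "cinner ((T ^^ k) x) y = cinner x ((R ^^ k) y)"
  by (rule cinner_funpow_adjoint) (rule adj)

lemma adj_pow': "cinner ((R ^^ k) x) y = cinner x ((T ^^ k) y)"
  by (rule cinner_funpow_adjoint) (rule adj')

lemma bounded_linear_R: "bounded_linear R"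
  using contraction_R by (intro operator_on_bounded_linear) (simp add: contraction_def)

lemma norm_R_le: "norm (R x) \<le> norm x"
  using contraction_R by (simp add: contraction_def)

text \<open>For a contraction, \<open>\<parallel>h - T\<^sup>*T h\<parallel>\<^sup>2 = \<parallel>h\<parallel>\<^sup>2 - 2 \<parallel>T h\<parallel>\<^sup>2 + \<parallel>T\<^sup>*T h\<parallel>\<^sup>2\<close>; this turns isometry at a single vector
  into a linear condition.\<close>

lemma isometric_at_iff: "norm (T h) = norm h \<longleftrightarrow> R (T h) = h"
proof
  assume eq: "norm (T h) = norm h"
  have "cinner (h - R (T h)) (h - R (T h)) =
      cinner h h - cinner (T h) (T h) - cinner (T h) (T h) + cinner (R (T h)) (R (T h))"
    by (simp add: cinner_diff_left cinner_diff_right adj adj')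
  also have "\<dots> = complex_of_real ((norm (R (T h)))\<^sup>2 - (norm h)\<^sup>2)"
    by (simp add: cinner_self eq)
  finally have "(norm (h - R (T h)))\<^sup>2 = (norm (R (T h)))\<^sup>2 - (norm h)\<^sup>2"
    unfolding cinner_self of_real_eq_iff .
  also have "\<dots> \<le> 0"
    using power_mono[OF order_trans[OF norm_R_le norm_T_le] norm_ge_zero, of h 2] by simp
  finally show "R (T h) = h" by simp
next
  assume "R (T h) = h"
  hence "norm h \<le> norm (T h)" using norm_R_le[of "T h"] by simp
  thus "norm (T h) = norm h" using norm_T_le[of h] by simp
qed

lemma isometric_part_iff: "h \<in> isometric_part T \<longleftrightarrow> (\<forall>k. R (T ((T ^^ k) h)) = (T ^^ k) h)"
  unfolding isometric_part_def by (simp add: isometric_at_iff)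

lemma isometric_part_R_T: "h \<in> isometric_part T \<Longrightarrow> R (T h) = h"
  by (metis isometric_part_iff funpow_0)

lemma isometric_part_T: "h \<in> isometric_part T \<Longrightarrow> T h \<in> isometric_part T"
  unfolding isometric_part_iff by (metis funpow_swap1 funpow.simps(2) o_apply)

lemma isometric_part_T_pow: "h \<in> isometric_part T \<Longrightarrow> (T ^^ k) h \<in> isometric_part T"
  by (induction k) (simp_all add: isometric_part_T)

lemma isometric_part_R_T_pow: "h \<in> isometric_part T \<Longrightarrow> (R ^^ k) ((T ^^ k) h) = h"
proof (induction k)
  case (Suc k)
  have "(R ^^ Suc k) y = (R ^^ k) (R y)" for y by (simp only: funpow_Suc_right o_apply)
  hence "(R ^^ Suc k) ((T ^^ Suc k) h) = (R ^^ k) (R (T ((T ^^ k) h)))" by simp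
  thus ?case using Suc isometric_part_iff by simp
qed simp

lemma isometric_part_cinner: "h \<in> isometric_part T \<Longrightarrow> cinner ((T ^^ k) h) ((T ^^ k) g) = cinner h g"
  by (simp add: adj_pow' [symmetric] isometric_part_R_T_pow)

lemma isometric_part_norm: "h \<in> isometric_part T \<Longrightarrow> norm ((T ^^ k) h) = norm h"
  by (induction k) (auto simp: isometric_part_def)

lemma closed_csubspace_isometric_part: "closed_csubspace (isometric_part T)"
proof -
  interpret T: bounded_linear T by (rule bounded_linear_T)
  interpret R: bounded_linear R by (rule bounded_linear_R)
  interpret dual: cnu_adjoint_pair R T by (rule dual)
  have "isometric_part T = (\<Inter>k. {h. R (T ((T ^^ k) h)) = (T ^^ k) h})"
    by (auto simp: isometric_part_iff)
  moreover have "closed {h. R (T ((T ^^ k) h)) = (T ^^ k) h}" for k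
    by (intro closed_Collect_eq linear_continuous_on bounded_linear_T_pow
        bounded_linear_compose[OF bounded_linear_R] bounded_linear_compose[OF bounded_linear_T])
  ultimately have "closed (isometric_part T)" by auto
  moreover have "csubspace (isometric_part T)"
    unfolding csubspace_def isometric_part_iff
    by (simp add: linear_simps[OF bounded_linear_T_pow] T_pow_scaleC T_scaleC T.add R.add T.zero R.zero
        dual.T_scaleC isometric_part_iff[THEN iffD1, rule_format])
  ultimately show ?thesis by (simp add: closed_csubspace_def)
qed

text \<open>
  The vectors of the isometric part \<open>I\<close> that can be pulled back within \<open>I\<close> arbitrarily often form a
  subspace that reduces \<open>T\<close> and on which \<open>T\<close> is unitary. This is where complete non unitarity enters:
  \<open>T\<close> is a pure shift on each of its invariant subspaces in \<open>I\<close>.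
\<close>

lemma isometric_part_pure:
  assumes "\<And>k. \<exists>y\<in>isometric_part T. x = (T ^^ k) y"
  shows "x = 0"
proof -
  let ?I = "isometric_part T"
  \<comment> \<open>\<open>M\<close> is the intersection of the \<open>T\<^sup>k I\<close>, written so that its closedness is visible.\<close>
  define M where "M = {m. \<forall>k. (R ^^ k) m \<in> ?I \<and> (T ^^ k) ((R ^^ k) m) = m}"
  interpret T: bounded_linear T by (rule bounded_linear_T)
  interpret R: bounded_linear R by (rule bounded_linear_R)
  interpret dual: cnu_adjoint_pair R T by (rule dual)
  have I: "closed_csubspace ?I" by (rule closed_csubspace_isometric_part)
  have "closed_csubspace M"
  proof -
    have "M = (\<Inter>k. ((R ^^ k) -` ?I) \<inter> {m. (T ^^ k) ((R ^^ k) m) = m})"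
      by (auto simp: M_def)
    moreover have "closed ((R ^^ k) -` ?I)" for k
      using I by (intro continuous_closed_vimage linear_continuous_at dual.bounded_linear_T_pow)
        (simp add: closed_csubspace_def)
    moreover have "closed {m. (T ^^ k) ((R ^^ k) m) = m}" for k
      by (intro closed_Collect_eq linear_continuous_on dual.bounded_linear_T_pow
          bounded_linear_compose[OF bounded_linear_T_pow] bounded_linear_ident)
    ultimately have "closed M" by auto
    moreover have "csubspace M"
      using I unfolding csubspace_def M_def closed_csubspace_def
      by (simp add: linear_simps[OF bounded_linear_T_pow] linear_simps[OF dual.bounded_linear_T_pow]
          T_pow_scaleC dual.T_pow_scaleC)
    ultimately show ?thesis by (simp add: closed_csubspace_def)
  qed
  moreover have "T m \<in> M \<and> R m \<in> M \<and> R (T m) = m \<and> T (R m) = m" if m: "m \<in> M" for m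
  proof -
    have Rk: "(R ^^ k) m \<in> ?I" and TR: "(T ^^ k) ((R ^^ k) m) = m" for k
      using m by (auto simp: M_def)
    have mI: "m \<in> ?I" using Rk[of 0] by simp
    have RT: "R (T m) = m" by (rule isometric_part_R_T[OF mI])
    have TRm: "T (R m) = m" using TR[of 1] by simp
    have "(R ^^ k) (T m) \<in> ?I \<and> (T ^^ k) ((R ^^ k) (T m)) = T m" for k
    proof (cases k)
      case 0
      thus ?thesis using isometric_part_T[OF mI] by simp
    next
      case (Suc j)
      have "(R ^^ k) (T m) = (R ^^ j) m" by (simp only: Suc funpow_Suc_right o_apply RT)
      thus ?thesis using Rk TR[of j] by (simp add: Suc)
    qed
    moreover have "(R ^^ k) (R m) \<in> ?I \<and> (T ^^ k) ((R ^^ k) (R m)) = R m" for k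
    proof -
      have eq: "(R ^^ k) (R m) = (R ^^ Suc k) m" by (simp only: funpow_Suc_right o_apply)
      have "T ((T ^^ k) ((R ^^ Suc k) m)) = m" using TR[of "Suc k"] by simp
      moreover have "R (T ((T ^^ k) ((R ^^ Suc k) m))) = (T ^^ k) ((R ^^ Suc k) m)"
        using Rk[of "Suc k"] isometric_part_iff by simp
      ultimately have "(T ^^ k) ((R ^^ Suc k) m) = R m" by (simp del: funpow.simps)
      thus ?thesis unfolding eq using Rk[of "Suc k"] by simp
    qed
    ultimately show ?thesis using RT TRm by (simp add: M_def)
  qed
  ultimately have "M = {0}" by (rule no_unitary_part)
  moreover have "(R ^^ k) x \<in> ?I \<and> (T ^^ k) ((R ^^ k) x) = x" for k
  proof -
    obtain y where y: "y \<in> ?I" "x = (T ^^ k) y" using assms by blast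
    thus ?thesis by (simp add: isometric_part_R_T_pow)
  qed
  hence "x \<in> M" by (simp add: M_def)
  ultimately show ?thesis by simp
qed

definition invariant_isometric :: "'a set \<Rightarrow> bool" where
  "invariant_isometric B \<longleftrightarrow> closed_csubspace B \<and> T ` B \<subseteq> B \<and> B \<subseteq> isometric_part T"

lemma invariant_isometric_T_pow: "invariant_isometric B \<Longrightarrow> b \<in> B \<Longrightarrow> (T ^^ k) b \<in> B"
  by (induction k) (auto simp: invariant_isometric_def)

text \<open>Since \<open>R T = 1\<close> on \<open>B\<close>, the image consists of the \<open>x\<close> with \<open>R x \<in> B\<close> and \<open>T (R x) = x\<close>, a closed
  condition.\<close>

lemma closed_csubspace_image:
  assumes "invariant_isometric B"
  shows "closed_csubspace (T ` B)"
proof -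
  interpret T: bounded_linear T by (rule bounded_linear_T)
  interpret dual: cnu_adjoint_pair R T by (rule dual)
  have B: "closed_csubspace B" and I: "B \<subseteq> isometric_part T"
    using assms by (auto simp: invariant_isometric_def)
  have eq: "T ` B = (R -` B) \<inter> {x. T (R x) = x}"
  proof (intro equalityI subsetI)
    fix x assume "x \<in> T ` B"
    then obtain b where "b \<in> B" "x = T b" by auto
    thus "x \<in> (R -` B) \<inter> {x. T (R x) = x}" using I isometric_part_R_T by auto
  next
    fix x assume "x \<in> (R -` B) \<inter> {x. T (R x) = x}"
    thus "x \<in> T ` B" by (auto intro: rev_image_eqI[of "R x"])
  qed
  have "closed (R -` B)"
    using B by (intro continuous_closed_vimage linear_continuous_at bounded_linear_R)
      (simp add: closed_csubspace_def)
  moreover have "closed {x. T (R x) = x}"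
    by (intro closed_Collect_eq linear_continuous_on bounded_linear_ident
        bounded_linear_compose[OF bounded_linear_T] bounded_linear_R)
  moreover have "csubspace (T ` B)"
    using B unfolding closed_csubspace_def csubspace_def
    by (auto simp flip: T.add T_scaleC intro: rev_image_eqI[of 0])
  ultimately show ?thesis unfolding closed_csubspace_def by (simp add: eq closed_Int)
qed

abbreviation wandering :: "'a set \<Rightarrow> 'a set" where
  "wandering B \<equiv> ortho_minus B (T ` B)"

lemma csubspace_wandering:
  assumes "invariant_isometric B"
  shows "csubspace (wandering B)"
  using assms unfolding invariant_isometric_def closed_csubspace_def csubspace_def ortho_minus_def
  by (auto simp: cinner_add_left cinner_scaleC_left)

lemma wandering_orthogonal:
  assumes B: "invariant_isometric B" and w: "w \<in> wandering B" and b: "b \<in> B" and k: "k > 0"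
  shows "cinner w ((T ^^ k) b) = 0"
proof -
  obtain j where j: "k = Suc j" using k by (cases k) auto
  have "(T ^^ k) b = T ((T ^^ j) b)" by (simp add: j)
  thus ?thesis using w invariant_isometric_T_pow[OF B b, of j] by (auto simp: ortho_minus_def)
qed

text \<open>
  Wold's theorem: translates of an orthonormal set of wandering vectors are orthonormal, and those
  of a total one are total, since a vector orthogonal to all of them can be pulled back for ever.
\<close>

lemma wold_orthonormal:
  assumes B: "invariant_isometric B" and E: "E \<subseteq> wandering B" "orthonormal_family (\<lambda>e. e) E"
  shows "orthonormal_family (\<lambda>(k, e). (T ^^ k) e) (UNIV \<times> E)"
proof -
  have BI: "E \<subseteq> B" "E \<subseteq> isometric_part T"
    using B E by (auto simp: invariant_isometric_def ortho_minus_def)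
  have shift: "cinner ((T ^^ (k + j)) e) ((T ^^ k) e') = 0"
    "cinner ((T ^^ k) e) ((T ^^ (k + j)) e') = 0"
    if "e \<in> E" "e' \<in> E" "j > 0" for e e' k j
  proof -
    have "cinner ((T ^^ k) e) ((T ^^ (k + j)) e') = cinner e ((T ^^ j) e')"
      using that BI by (simp add: funpow_add isometric_part_cinner subset_iff)
    also have "\<dots> = 0" using that BI E by (intro wandering_orthogonal[OF B]) auto
    finally show 2: "cinner ((T ^^ k) e) ((T ^^ (k + j)) e') = 0" .
    have "cinner ((T ^^ k) e') ((T ^^ (k + j)) e) = cinner e' ((T ^^ j) e)"
      using that BI by (simp add: funpow_add isometric_part_cinner subset_iff)
    also have "\<dots> = 0" using that BI E by (intro wandering_orthogonal[OF B]) auto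
    finally show "cinner ((T ^^ (k + j)) e) ((T ^^ k) e') = 0"
      using cinner_commute[of "(T ^^ (k + j)) e"] by simp
  qed
  have "cinner ((T ^^ k) e) ((T ^^ l) e') = (if k = l \<and> e = e' then 1 else 0)"
    if e: "e \<in> E" "e' \<in> E" for k l e e'
  proof (cases k l rule: linorder_cases)
    case less
    then obtain j where "l = k + j" "j > 0" using less_imp_add_positive by blast
    thus ?thesis using shift(2)[OF e] by simp
  next
    case equal
    thus ?thesis using E(2) e BI by (simp add: isometric_part_cinner subset_iff orthonormal_family_def)
  next
    case greater
    then obtain j where "k = l + j" "j > 0" using less_imp_add_positive by blast
    thus ?thesis using shift(1)[OF e] by simp
  qed
  thus ?thesis by (auto simp: orthonormal_family_def)
qed

lemma wold_total:
  assumes B: "invariant_isometric B" and E: "total_in (\<lambda>e. e) E (wandering B)"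
  shows "total_in (\<lambda>(k, e). (T ^^ k) e) (UNIV \<times> E) B"
  unfolding total_in_def
proof (intro conjI ballI impI)
  have EB: "E \<subseteq> B" using E by (auto simp: total_in_def ortho_minus_def)
  have BI: "B \<subseteq> isometric_part T" and Bc: "closed_csubspace B" and TB: "T ` B \<subseteq> B"
    using B by (auto simp: invariant_isometric_def)
  show "(\<lambda>(k, e). (T ^^ k) e) ` (UNIV \<times> E) \<subseteq> B"
    using EB invariant_isometric_T_pow[OF B] by auto
  fix x assume x: "x \<in> B" and orth: "\<forall>i\<in>UNIV \<times> E. cinner x (case i of (k, e) \<Rightarrow> (T ^^ k) e) = 0"
  have "\<exists>y\<in>B. x = (T ^^ k) y" for k
  proof (induction k)
    case 0
    thus ?case using x by simp
  next
    case (Suc k)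
    then obtain y where y: "y \<in> B" "x = (T ^^ k) y" by blast
    have yE: "cinner y e = 0" if "e \<in> E" for e
      using orth that y BI isometric_part_cinner[of y k e] by auto
    let ?p = "ortho_proj (T ` B) y"
    have TBc: "closed_csubspace (T ` B)" by (rule closed_csubspace_image[OF B])
    have p: "?p \<in> T ` B" by (rule ortho_proj_in[OF TBc])
    have w: "y - ?p \<in> wandering B"
      using p TB y Bc cinner_ortho_proj_left[OF TBc]
      by (auto simp: ortho_minus_def cinner_diff_left closed_csubspace_def intro!: csubspace_diff)
    have "cinner (y - ?p) e = 0" if e: "e \<in> E" for e
    proof -
      have "e \<in> wandering B" using E e by (auto simp: total_in_def)
      hence "cinner e ?p = 0" using p by (auto simp: ortho_minus_def)
      thus ?thesis using yE[OF e] cinner_commute[of ?p e] by (simp add: cinner_diff_left)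
    qed
    hence "y - ?p = 0" using E w by (auto simp: total_in_def)
    then obtain b where "b \<in> B" "y = T b" using p by auto
    thus ?case using y by (intro bexI[of _ b]) (simp_all add: funpow_swap1)
  qed
  hence "\<exists>y\<in>isometric_part T. x = (T ^^ k) y" for k using BI by blast
  thus "x = 0" by (rule isometric_part_pure)
qed

end

section \<open>Multiplicities\<close>

lemma has_sum_finite_sum:
  fixes f :: "'i \<Rightarrow> 'j \<Rightarrow> 'b::topological_comm_monoid_add"
  assumes "finite F" "\<And>w. w \<in> F \<Longrightarrow> (f w has_sum s w) I"
  shows "((\<lambda>i. \<Sum>w\<in>F. f w i) has_sum (\<Sum>w\<in>F. s w)) I"
  using assms by (induction F rule: finite_induct) (auto intro!: has_sum_add)

lemma orthonormal_family_subset: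
  assumes "orthonormal_family e I" "J \<subseteq> I"
  shows "orthonormal_family e J"
  unfolding orthonormal_family_def
proof (intro ballI)
  fix i j assume "i \<in> J" "j \<in> J"
  thus "cinner (e i) (e j) = (if i = j then 1 else 0)"
    using assms unfolding orthonormal_family_def by blast
qed

lemma orthonormal_family_norm:
  assumes "orthonormal_family e I" "i \<in> I"
  shows "norm (e i) = 1"
proof -
  have "complex_of_real ((norm (e i))\<^sup>2) = complex_of_real 1"
    using assms unfolding cinner_self[symmetric] orthonormal_family_def by simp
  hence "(norm (e i))\<^sup>2 = 1" unfolding of_real_eq_iff .
  thus ?thesis using norm_ge_zero[of "e i"] by (simp add: power2_eq_1_iff)
qed

text \<open>\<open>U\<close> carries the Fourier coefficients along one basis to those along the other.\<close>

lemma unitary_from_orthonormal_families: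
  fixes e f :: "'i \<Rightarrow> 'a::complex_hilbert"
  assumes A: "closed_csubspace A" and e: "orthonormal_family e I" "total_in e I A"
    and B: "closed_csubspace B" and f: "orthonormal_family f I" "total_in f I B"
  obtains U where "unitary_on A B U" "\<And>x i. x \<in> A \<Longrightarrow> i \<in> I \<Longrightarrow> cinner (U x) (f i) = cinner x (e i)"
proof -
  have transfer: "\<exists>s\<in>L. (\<forall>i\<in>I. cinner s (h i) = cinner x (g i)) \<and> (x \<in> K \<longrightarrow> norm s = norm x)"
    if K: "closed_csubspace K" "orthonormal_family g I" "total_in g I K"
      and L: "closed_csubspace L" "orthonormal_family h I" "total_in h I L"
    for K L :: "'a set" and g h :: "'i \<Rightarrow> 'a" and x
  proof -
    have "\<exists>s. ((\<lambda>i. cinner x (g i) *\<^sub>C h i) has_sum s) I \<and> (\<forall>i\<in>I. cinner s (h i) = cinner x (g i)) \<and>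
        ((\<lambda>i. (cmod (cinner x (g i)))\<^sup>2) has_sum (norm s)\<^sup>2) I"
      by (rule riesz_fischer[OF L(2) bessel[OF K(2)]])
    then obtain s where s: "((\<lambda>i. cinner x (g i) *\<^sub>C h i) has_sum s) I"
      "\<forall>i\<in>I. cinner s (h i) = cinner x (g i)"
      "((\<lambda>i. (cmod (cinner x (g i)))\<^sup>2) has_sum (norm s)\<^sup>2) I"
      by (elim exE conjE)
    have "s \<in> L"
      using L by (intro has_sum_in_closed_csubspace[OF s(1)])
        (auto simp: total_in_def closed_csubspace_def csubspace_def)
    moreover have "norm s = norm x" if x: "x \<in> K"
      using has_sum_unique[OF s(3) fourier_expansion(2)[OF K(2,3,1) x]] by simp
    ultimately show ?thesis using s(2) by auto
  qed
  have "\<forall>x. \<exists>s. s \<in> B \<and> (\<forall>i\<in>I. cinner s (f i) = cinner x (e i)) \<and> (x \<in> A \<longrightarrow> norm s = norm x)"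
    using transfer[OF A e B f] by auto
  then obtain U where U: "\<forall>x. U x \<in> B \<and> (\<forall>i\<in>I. cinner (U x) (f i) = cinner x (e i)) \<and>
      (x \<in> A \<longrightarrow> norm (U x) = norm x)"
    using choice[of "\<lambda>x s. s \<in> B \<and> (\<forall>i\<in>I. cinner s (f i) = cinner x (e i)) \<and>
      (x \<in> A \<longrightarrow> norm s = norm x)"] by auto
  hence UB: "U x \<in> B" and coeff: "i \<in> I \<Longrightarrow> cinner (U x) (f i) = cinner x (e i)"
    and iso: "x \<in> A \<Longrightarrow> norm (U x) = norm x" for x i by auto
  have Bc: "csubspace B" using B by (simp add: closed_csubspace_def)
  have "U (x + y) = U x + U y" for x y
    using Bc UB by (intro total_in_eqI[OF f(2) Bc])
      (auto simp: csubspace_def cinner_add_left coeff)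
  moreover have "U (c *\<^sub>C x) = c *\<^sub>C U x" for c x
    using Bc UB by (intro total_in_eqI[OF f(2) Bc])
      (auto simp: csubspace_def cinner_scaleC_left coeff)
  ultimately have "isometry_on A B U"
    unfolding isometry_on_def operator_on_def using UB iso by (auto intro!: exI[of _ 1])
  moreover have "U ` A = B"
  proof (intro equalityI subsetI)
    fix y assume y: "y \<in> B"
    obtain x where x: "x \<in> A" "\<forall>i\<in>I. cinner x (e i) = cinner y (f i)"
      using transfer[OF B f A e, of y] by auto
    have "U x = y" using x y UB by (intro total_in_eqI[OF f(2) Bc]) (auto simp: coeff)
    thus "y \<in> U ` A" using x by auto
  qed (use UB in auto)
  ultimately have "unitary_on A B U" by (simp add: unitary_on_def)
  thus ?thesis using that coeff by metis
qed

text \<open>Distinct orthonormal vectors have distance \<open>sqrt 2\<close>, so the balls of radius \<open>1/2\<close> around them are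
  disjoint and each contains a point of a countable dense set.\<close>

lemma orthonormal_set_countable:
  fixes E :: "'a::complex_inner set"
  assumes sep: "separable_space (euclidean :: 'a topology)" and E: "orthonormal_family (\<lambda>e. e) E"
  shows "countable E"
proof -
  obtain C :: "'a set" where C: "countable C" "closure C = UNIV"
    using sep by (auto simp: separable_space_def)
  have "\<exists>c. c \<in> C \<and> dist c e < 1 / 2" for e
    using C(2) closure_approachable[of e C] by (metis UNIV_I half_gt_zero_iff zero_less_one)
  then obtain g where g: "\<And>e. g e \<in> C" "\<And>e. dist (g e) e < 1 / 2" by metis
  have "inj_on g E"
  proof (rule inj_onI, rule ccontr)
    fix e e' assume ee: "e \<in> E" "e' \<in> E" "g e = g e'" "e \<noteq> e'"
    have "dist e e' < 1"
      using g(2)[of e] g(2)[of e'] dist_triangle3[of e e' "g e"] ee(3) by simp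
    hence "(norm (e - e'))\<^sup>2 < 1" by (simp add: dist_norm power_less_one_iff)
    moreover have "cinner (e - e') (e - e') = 2"
      using E ee by (simp add: orthonormal_family_def cinner_diff_left cinner_diff_right)
    hence "complex_of_real ((norm (e - e'))\<^sup>2) = complex_of_real 2" by (simp add: cinner_self)
    hence "(norm (e - e'))\<^sup>2 = 2" unfolding of_real_eq_iff .
    ultimately show False by simp
  qed
  moreover have "countable (g ` E)" using g(1) C(1) by (meson countable_subset image_subsetI)
  ultimately show ?thesis by (rule countable_image_inj_on[rotated])
qed

lemma norm_ortho_proj:
  fixes M :: "'a::complex_hilbert set"
  assumes M: "closed_csubspace M"
  shows norm_ortho_proj_le: "norm (ortho_proj M y) \<le> norm y"
    and norm_ortho_proj_ge: "b \<in> M \<Longrightarrow> norm y - norm (y - b) \<le> norm (ortho_proj M y)"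
proof -
  let ?p = "ortho_proj M y"
  have pyth: "(norm (y - b))\<^sup>2 = (norm (y - ?p))\<^sup>2 + (norm (?p - b))\<^sup>2" if b: "b \<in> M" for b
  proof -
    have "?p - b \<in> M"
      using M b ortho_proj_in[OF M] by (intro csubspace_diff) (auto simp: closed_csubspace_def)
    hence "cinner (y - ?p) (?p - b) = 0"
      by (simp add: cinner_diff_left cinner_ortho_proj_left[OF M])
    hence "inner (y - ?p) (?p - b) = 0" by (simp add: inner_eq_Re_cinner)
    hence "(norm ((y - ?p) + (?p - b)))\<^sup>2 = (norm (y - ?p))\<^sup>2 + (norm (?p - b))\<^sup>2"
      by (intro norm_add_Pythagorean) (simp add: orthogonal_def)
    thus ?thesis by simp
  qed
  have "(norm ?p)\<^sup>2 \<le> (norm y)\<^sup>2"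
    using pyth[of 0] M by (simp add: closed_csubspace_def csubspace_def)
  thus "norm ?p \<le> norm y" by (rule power2_le_imp_le) simp
  assume b: "b \<in> M"
  have "(norm (y - ?p))\<^sup>2 \<le> (norm (y - b))\<^sup>2" using pyth[OF b] by simp
  hence "norm (y - ?p) \<le> norm (y - b)" by (rule power2_le_imp_le) simp
  thus "norm y - norm (y - b) \<le> norm ?p" using norm_triangle_ineq2[of y "y - ?p"] by simp
qed

context cnu_adjoint_pair begin

text \<open>Because \<open>\<parallel>T\<^sup>k h\<parallel> = \<parallel>h\<parallel>\<close> for \<open>h\<close> in the isometric part, convergence of the norms of the projections says
  that the distance of \<open>T\<^sup>k h\<close> to \<open>B\<close> tends to \<open>0\<close>.\<close>

definition absorbing :: "'a set \<Rightarrow> bool" where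
  "absorbing B \<longleftrightarrow> invariant_isometric B \<and>
    (\<forall>h\<in>isometric_part T. (\<lambda>k. norm (ortho_proj B ((T ^^ k) h))) \<longlonglongrightarrow> norm h)"

lemma absorbing_isometric_part: "absorbing (isometric_part T)"
  unfolding absorbing_def invariant_isometric_def
proof (intro conjI ballI)
  fix h assume h: "h \<in> isometric_part T"
  have "ortho_proj (isometric_part T) ((T ^^ k) h) = (T ^^ k) h" for k
    using closed_csubspace_isometric_part isometric_part_T_pow[OF h]
    by (intro ortho_proj_id) (auto simp: closed_csubspace_def)
  thus "(\<lambda>k. norm (ortho_proj (isometric_part T) ((T ^^ k) h))) \<longlonglongrightarrow> norm h"
    by (simp add: isometric_part_norm[OF h])
qed (auto simp: closed_csubspace_isometric_part isometric_part_T)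

text \<open>
  Since \<open>\<langle>T\<^sup>k w, T\<^sup>l e\<rangle> = \<langle>T\<^sup>k\<^sup>+\<^sup>N\<^sup>-\<^sup>l w, T\<^sup>N e\<rangle>\<close> and the vectors \<open>T\<^sup>k\<^sup>+\<^sup>N\<^sup>-\<^sup>l w\<close> are orthonormal, this is Bessel's
  inequality for the single vector \<open>T\<^sup>N e\<close>.
\<close>

lemma wandering_mass_le_one:
  assumes A: "invariant_isometric A" and F: "F \<subseteq> wandering A" "orthonormal_family (\<lambda>e. e) F"
    and fin: "finite F" and e: "norm e = 1"
  shows "(\<Sum>w\<in>F. \<Sum>l\<le>N. (cmod (cinner ((T ^^ k) w) ((T ^^ l) e)))\<^sup>2) \<le> 1"
proof -
  have FI: "w \<in> isometric_part T" if "w \<in> F" for w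
    using that F A by (auto simp: ortho_minus_def invariant_isometric_def)
  have shift: "cmod (cinner ((T ^^ k) w) ((T ^^ l) e)) = cmod (cinner ((T ^^ N) e) ((T ^^ (k + (N - l))) w))"
    if w: "w \<in> F" and l: "l \<le> N" for w l
  proof -
    have "cinner ((T ^^ k) w) ((T ^^ l) e) =
        cinner ((T ^^ (N - l)) ((T ^^ k) w)) ((T ^^ (N - l)) ((T ^^ l) e))"
      by (simp only: isometric_part_cinner[OF isometric_part_T_pow[OF FI[OF w]]])
    also have "(T ^^ (N - l)) ((T ^^ l) e) = (T ^^ N) e"
      using l by (simp add: funpow_add[symmetric, THEN fun_cong, unfolded o_apply])
    also have "(T ^^ (N - l)) ((T ^^ k) w) = (T ^^ (k + (N - l))) w"
      by (simp add: funpow_add[symmetric, THEN fun_cong, unfolded o_apply] add.commute)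
    finally show ?thesis using cinner_commute[of "(T ^^ N) e"] by simp
  qed
  let ?H = "(\<lambda>(w, l). (k + (N - l), w)) ` (F \<times> {..N})"
  have "(\<Sum>w\<in>F. \<Sum>l\<le>N. (cmod (cinner ((T ^^ k) w) ((T ^^ l) e)))\<^sup>2) =
      (\<Sum>w\<in>F. \<Sum>l\<le>N. (cmod (cinner ((T ^^ N) e) ((T ^^ (k + (N - l))) w)))\<^sup>2)"
    by (intro sum.cong refl) (simp add: shift)
  also have "\<dots> = (\<Sum>(w, l)\<in>F \<times> {..N}. (cmod (cinner ((T ^^ N) e) ((T ^^ (k + (N - l))) w)))\<^sup>2)"
    by (rule sum.cartesian_product)
  also have "\<dots> = (\<Sum>i\<in>?H. (cmod (cinner ((T ^^ N) e) (case i of (k, e) \<Rightarrow> (T ^^ k) e)))\<^sup>2)"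
    by (subst sum.reindex) (auto simp: inj_on_def intro!: sum.cong)
  also have "\<dots> \<le> (norm ((T ^^ N) e))\<^sup>2"
    using fin by (intro bessel[OF wold_orthonormal[OF A F]]) auto
  also have "\<dots> \<le> 1"
    using norm_T_pow_le[of N e] e by (simp add: power_le_one_iff)
  finally show ?thesis .
qed

text \<open>Halmos' count. The translates \<open>T\<^sup>l e\<close>, \<open>e \<in> E\<close>, form an orthonormal basis of \<open>B\<close>, so the squared norms of
  the projections of the \<open>T\<^sup>k w\<close> to \<open>B\<close> add up to at most \<open>1\<close> for each \<open>e\<close>. As \<open>B\<close> is
  absorbing, each of these norms tends to \<open>1\<close>.\<close>

lemma multiplicity_le:
  assumes A: "invariant_isometric A" and F: "F \<subseteq> wandering A" "orthonormal_family (\<lambda>e. e) F"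
    and B: "absorbing B" and E: "total_in (\<lambda>e. e) E (wandering B)" "orthonormal_family (\<lambda>e. e) E"
    and fin: "finite F" "finite E"
  shows "card F \<le> card E"
proof -
  have Bi: "invariant_isometric B" and Bc: "closed_csubspace B"
    using B by (auto simp: absorbing_def invariant_isometric_def)
  have EW: "E \<subseteq> wandering B" using E(1) by (simp add: total_in_def)
  have FI: "w \<in> isometric_part T" if "w \<in> F" for w
    using that F A by (auto simp: ortho_minus_def invariant_isometric_def)
  let ?e = "\<lambda>(l, e). (T ^^ l) e"
  have on: "orthonormal_family ?e (UNIV \<times> E)" by (rule wold_orthonormal[OF Bi EW E(2)])
  have tot: "total_in ?e (UNIV \<times> E) B" by (rule wold_total[OF Bi E(1)])
  have eB: "?e i \<in> B" if "i \<in> UNIV \<times> E" for i using tot that by (auto simp: total_in_def)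
  have "(\<Sum>w\<in>F. (norm (ortho_proj B ((T ^^ k) w)))\<^sup>2) \<le> real (card E)" for k
  proof (rule has_sum_le_finite_sums)
    let ?g = "\<lambda>i. \<Sum>w\<in>F. (cmod (cinner (ortho_proj B ((T ^^ k) w)) (?e i)))\<^sup>2"
    show "(?g has_sum (\<Sum>w\<in>F. (norm (ortho_proj B ((T ^^ k) w)))\<^sup>2)) (UNIV \<times> E)"
      by (intro has_sum_finite_sum fin fourier_expansion(2)[OF on tot Bc] ortho_proj_in[OF Bc])
    fix H :: "(nat \<times> 'a) set" assume H: "finite H" "H \<subseteq> UNIV \<times> E"
    define N where "N = Max (insert 0 (fst ` H))"
    have "fst p \<le> N" if "p \<in> H" for p unfolding N_def using H that by (intro Max_ge) auto
    hence HN: "H \<subseteq> {..N} \<times> E" using H by fastforce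
    have "sum ?g H \<le> sum ?g ({..N} \<times> E)"
      using HN fin by (intro sum_mono2) (auto intro: sum_nonneg)
    also have "\<dots> = (\<Sum>i\<in>{..N} \<times> E. \<Sum>w\<in>F. (cmod (cinner ((T ^^ k) w) (?e i)))\<^sup>2)"
      using eB by (intro sum.cong refl) (auto simp: cinner_ortho_proj_left[OF Bc])
    also have "\<dots> = (\<Sum>e\<in>E. \<Sum>w\<in>F. \<Sum>l\<le>N. (cmod (cinner ((T ^^ k) w) ((T ^^ l) e)))\<^sup>2)"
    proof -
      let ?q = "\<lambda>l e w. (cmod (cinner ((T ^^ k) w) ((T ^^ l) e)))\<^sup>2"
      have "(\<Sum>i\<in>{..N} \<times> E. \<Sum>w\<in>F. (cmod (cinner ((T ^^ k) w) (?e i)))\<^sup>2) =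
          (\<Sum>l\<le>N. \<Sum>e\<in>E. \<Sum>w\<in>F. ?q l e w)"
        unfolding sum.cartesian_product[of "\<lambda>l e. sum (?q l e) F" E "{..N}"]
        by (intro sum.cong refl) auto
      also have "\<dots> = (\<Sum>e\<in>E. \<Sum>l\<le>N. \<Sum>w\<in>F. ?q l e w)" by (rule sum.swap)
      also have "\<dots> = (\<Sum>e\<in>E. \<Sum>w\<in>F. \<Sum>l\<le>N. ?q l e w)" by (intro sum.cong refl sum.swap)
      finally show ?thesis .
    qed
    also have "\<dots> \<le> (\<Sum>e\<in>E. 1)"
      by (intro sum_mono wandering_mass_le_one[OF A F fin(1)] orthonormal_family_norm[OF E(2)])
    finally show "sum ?g H \<le> real (card E)" by simp
  qed
  moreover have "(\<lambda>k. \<Sum>w\<in>F. (norm (ortho_proj B ((T ^^ k) w)))\<^sup>2) \<longlonglongrightarrow> (\<Sum>w\<in>F. (norm w)\<^sup>2)"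
    using B FI by (intro tendsto_sum tendsto_power) (simp add: absorbing_def)
  ultimately have "(\<Sum>w\<in>F. (norm w)\<^sup>2) \<le> real (card E)" by (intro LIMSEQ_le_const2) auto
  thus ?thesis by (simp add: orthonormal_family_norm[OF F(2)])
qed

lemma multiplicity_finite_le:
  assumes A: "invariant_isometric A" and F: "F \<subseteq> wandering A" "orthonormal_family (\<lambda>e. e) F"
    and B: "absorbing B" and E: "total_in (\<lambda>e. e) E (wandering B)" "orthonormal_family (\<lambda>e. e) E"
    and fin: "finite E"
  shows "finite F \<and> card F \<le> card E"
proof (rule finite_if_finite_subsets_card_bdd)
  fix G assume G: "G \<subseteq> F" "finite G"
  hence "orthonormal_family (\<lambda>e. e) G" using F(2) orthonormal_family_subset by blast
  thus "card G \<le> card E" using G F by (intro multiplicity_le[OF A _ _ B E _ fin]) auto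
qed

text \<open>Equal multiplicities give a bijection between orthonormal bases of the wandering subspaces, and it
  extends to the translates because by Wold's theorem these are orthonormal bases of \<open>A\<close> and \<open>B\<close>.\<close>

lemma absorbing_unitarily_equivalent:
  assumes sep: "separable_space (euclidean :: 'a topology)"
    and A: "absorbing A" and B: "absorbing B"
  obtains U where "unitary_on A B U" "\<And>x. x \<in> A \<Longrightarrow> U (T x) = T (U x)"
proof -
  have Ai: "invariant_isometric A" and Bi: "invariant_isometric B"
    using A B by (auto simp: absorbing_def)
  hence Ac: "closed_csubspace A" and Bc: "closed_csubspace B"
    by (auto simp: invariant_isometric_def)
  obtain E where E: "orthonormal_family (\<lambda>e. e) E" "total_in (\<lambda>e. e) E (wandering A)"
    using total_orthonormal_subset_exists[OF csubspace_wandering[OF Ai]] .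
  obtain F where F: "orthonormal_family (\<lambda>e. e) F" "total_in (\<lambda>e. e) F (wandering B)"
    using total_orthonormal_subset_exists[OF csubspace_wandering[OF Bi]] .
  have EW: "E \<subseteq> wandering A" and FW: "F \<subseteq> wandering B" using E F by (auto simp: total_in_def)
  have "\<exists>\<phi>. bij_betw \<phi> E F"
  proof (cases "finite E \<or> finite F")
    case True
    hence "finite E" "finite F" "card E = card F"
      using multiplicity_finite_le[OF Ai EW E(1) B F(2) F(1)]
        multiplicity_finite_le[OF Bi FW F(1) A E(2) E(1)] by auto
    thus ?thesis by (rule finite_same_card_bij)
  next
    case False
    hence "bij_betw (to_nat_on E) E UNIV" "bij_betw (from_nat_into F) UNIV F"
      using orthonormal_set_countable[OF sep] E(1) F(1)
      by (auto intro: to_nat_on_infinite bij_betw_from_nat_into)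
    thus ?thesis using bij_betw_trans by blast
  qed
  then obtain \<phi> where \<phi>: "bij_betw \<phi> E F" ..
  let ?e = "\<lambda>(k::nat, e). (T ^^ k) e" and ?f = "\<lambda>(k::nat, e). (T ^^ k) (\<phi> e)"
  have on: "orthonormal_family ?e (UNIV \<times> E)" by (rule wold_orthonormal[OF Ai EW E(1)])
  have tot: "total_in ?e (UNIV \<times> E) A" by (rule wold_total[OF Ai E(2)])
  have \<phi>F: "\<phi> e \<in> F" if "e \<in> E" for e using \<phi> that by (auto simp: bij_betw_def)
  have onf: "orthonormal_family ?f (UNIV \<times> E)"
    using wold_orthonormal[OF Bi FW F(1)] \<phi> \<phi>F
    unfolding orthonormal_family_def bij_betw_def by (auto simp: inj_on_eq_iff)
  have img: "?f ` (UNIV \<times> E) = (\<lambda>(k::nat, e). (T ^^ k) e) ` (UNIV \<times> F)"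
    using \<phi> by (force simp: bij_betw_def image_def)
  have totf: "total_in ?f (UNIV \<times> E) B"
    using wold_total[OF Bi F(2)] img unfolding total_in_def
    by (metis (no_types, lifting) image_iff)
  obtain U where U: "unitary_on A B U"
    and coeff: "\<And>x i. x \<in> A \<Longrightarrow> i \<in> UNIV \<times> E \<Longrightarrow> cinner (U x) (?f i) = cinner x (?e i)"
    using unitary_from_orthonormal_families[OF Ac on tot Bc onf totf] by metis
  have UB: "U x \<in> B" if "x \<in> A" for x
    using U that by (auto simp: unitary_on_def isometry_on_def operator_on_def)
  have TA: "T x \<in> A" if "x \<in> A" for x using Ai that by (auto simp: invariant_isometric_def)
  have TB: "T x \<in> B" if "x \<in> B" for x using Bi that by (auto simp: invariant_isometric_def)
  have "U (T x) = T (U x)" if x: "x \<in> A" for x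
  proof (rule total_in_eqI[OF totf])
    show "csubspace B" using Bc by (simp add: closed_csubspace_def)
    show "U (T x) \<in> B" "T (U x) \<in> B" using x TA UB TB by auto
    fix i :: "nat \<times> 'a" assume "i \<in> UNIV \<times> E"
    then obtain k :: nat and e where i: "i = (k, e)" "e \<in> E" by auto
    have coeff': "cinner (U y) ((T ^^ k) (\<phi> e)) = cinner y ((T ^^ k) e)" if "y \<in> A" for y and k :: nat
      using coeff[OF that, of "(k, e)"] i by simp
    have "cinner (T x) ((T ^^ k) e) = cinner (T (U x)) ((T ^^ k) (\<phi> e))"
    proof (cases k)
      case 0
      have "e \<in> wandering A" "\<phi> e \<in> wandering B"
        using subsetD[OF EW i(2)] subsetD[OF FW \<phi>F[OF i(2)]] by simp_all
      hence "cinner e (T x) = 0" "cinner (\<phi> e) (T (U x)) = 0"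
        using x UB[OF x] by (simp_all add: ortho_minus_def)
      thus ?thesis using cinner_commute[of "T x" e] cinner_commute[of "T (U x)" "\<phi> e"] by (simp add: 0)
    next
      case (Suc j)
      have "cinner (T x) (T y) = cinner x y" "cinner (T (U x)) (T y) = cinner (U x) y" for y
        using isometric_part_cinner[of x 1] isometric_part_cinner[of "U x" 1] x UB[OF x] Ai Bi
        by (auto simp: invariant_isometric_def)
      thus ?thesis using coeff'[OF x, of j] by (simp add: Suc)
    qed
    thus "cinner (U (T x)) (?f i) = cinner (T (U x)) (?f i)"
      using coeff'[OF TA[OF x], of k] by (simp add: i)
  qed
  thus ?thesis using that U by blast
qed

end

section \<open>Canonical and triangular representations\<close>

lemma closed_csubspace_vimage:
  assumes M: "closed_csubspace M" and A: "operator_on UNIV UNIV A"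
  shows "closed_csubspace (A -` M)"
proof -
  have bl: "bounded_linear A" by (rule operator_on_bounded_linear[OF A])
  have "closed (A -` M)"
    using M by (intro continuous_closed_vimage linear_continuous_at bl) (simp add: closed_csubspace_def)
  moreover have "csubspace (A -` M)"
    using M unfolding closed_csubspace_def csubspace_def
    by (simp add: linear_simps[OF bl] operator_on_scaleC[OF A])
  ultimately show ?thesis by (simp add: closed_csubspace_def)
qed

lemma closed_csubspace_closure:
  fixes M :: "'a::complex_inner set"
  assumes M: "csubspace M"
  shows "closed_csubspace (closure M)"
  unfolding closed_csubspace_def csubspace_def
proof (intro conjI ballI allI)
  show "0 \<in> closure M" using M closure_subset by (auto simp: csubspace_def)
  fix x y :: 'a and c assume x: "x \<in> closure M"
  have "(\<lambda>x. c *\<^sub>C x) ` closure M \<subseteq> closure ((\<lambda>x. c *\<^sub>C x) ` M)"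
    by (intro image_closure_subset linear_continuous_on bounded_linear_scaleC closed_closure
        closure_subset)
  also have "\<dots> \<subseteq> closure M" using M by (intro closure_mono) (auto simp: csubspace_def)
  finally show "c *\<^sub>C x \<in> closure M" using x by auto
next
  fix x y :: 'a assume "x \<in> closure M" "y \<in> closure M"
  then obtain f g where "\<forall>n. f n \<in> M" "f \<longlonglongrightarrow> x" and "\<forall>n. g n \<in> M" "g \<longlonglongrightarrow> y"
    unfolding closure_sequential by (elim exE conjE)
  hence "\<forall>n. f n + g n \<in> M" "(\<lambda>n. f n + g n) \<longlonglongrightarrow> x + y"
    using M by (auto simp: csubspace_def intro: tendsto_add)
  thus "x + y \<in> closure M"
    unfolding closure_sequential by (intro exI[of _ "\<lambda>n. f n + g n"] conjI)
qed auto

lemma closed_csubspace_closed_cspan: "closed_csubspace (closed_cspan (X::'a::complex_inner set))"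
proof -
  have "csubspace (\<Inter>S)" if "\<forall>M\<in>S. csubspace M" for S :: "'a set set"
    using that by (simp add: csubspace_def)
  hence "csubspace (csubspace hull X)" by (rule hull_in)
  thus ?thesis unfolding closed_cspan_def by (rule closed_csubspace_closure)
qed

lemma closed_cspan_superset: "X \<subseteq> closed_cspan X"
  unfolding closed_cspan_def by (rule order_trans[OF hull_subset closure_subset])

lemma closed_cspan_minimal: "closed_csubspace M \<Longrightarrow> X \<subseteq> M \<Longrightarrow> closed_cspan X \<subseteq> M"
  unfolding closed_cspan_def closed_csubspace_def by (simp add: closure_minimal hull_minimal)

text \<open>Polarization, carried out for the real part; the imaginary part is the real part for \<open>\<i> y\<close>.\<close>

lemma unitary_on_cinner:
  assumes U: "unitary_on A B U" and A: "csubspace A" and x: "x \<in> A" and y: "y \<in> A"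
  shows "cinner (U x) (U y) = cinner x y"
proof -
  have add: "\<And>x y. x \<in> A \<Longrightarrow> y \<in> A \<Longrightarrow> U (x + y) = U x + U y"
    and sc: "\<And>c x. x \<in> A \<Longrightarrow> U (c *\<^sub>C x) = c *\<^sub>C U x"
    and iso: "\<And>x. x \<in> A \<Longrightarrow> norm (U x) = norm x"
    using U by (auto simp: unitary_on_def isometry_on_def operator_on_def)
  have re: "Re (cinner (U x) (U y)) = Re (cinner x y)" if "y \<in> A" for y
  proof -
    have "x + y \<in> A" using A x that by (simp add: csubspace_def)
    thus ?thesis
      unfolding inner_eq_Re_cinner[symmetric] dot_norm
      by (simp add: iso x that flip: add)
  qed
  have im: "Im (cinner u v) = Re (cinner u (\<i> *\<^sub>C v))" for u v :: 'a
    by (simp add: cinner_scaleC_right)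
  have "\<i> *\<^sub>C y \<in> A" using A y by (simp add: csubspace_def)
  hence "Im (cinner (U x) (U y)) = Im (cinner x y)"
    unfolding im sc[OF y, symmetric] by (rule re)
  thus ?thesis using re[OF y] by (simp add: complex_eq_iff)
qed

context cnu_adjoint_pair begin

text \<open>
  On a \<open>T\<^sup>*\<close>-invariant subspace where \<open>T\<^sup>*\<close> is isometric, the compression of \<open>T\<close> is a co-shift, whose
  powers tend strongly to \<open>0\<close>: they eventually annihilate any finite combination of the \<open>T\<^sup>*\<^sup>l e\<close> with \<open>e\<close>
  wandering, and these combinations are dense.
\<close>

lemma coshift_projection_tendsto_0:
  assumes C: "cnu_adjoint_pair.invariant_isometric R C"
  shows "(\<lambda>k. norm (ortho_proj C ((T ^^ k) h))) \<longlonglongrightarrow> 0"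
proof -
  interpret dual: cnu_adjoint_pair R T by (rule dual)
  have Cc: "closed_csubspace C" using C by (simp add: dual.invariant_isometric_def)
  obtain E where E: "orthonormal_family (\<lambda>e. e) E" "total_in (\<lambda>e. e) E (dual.wandering C)"
    using total_orthonormal_subset_exists[OF dual.csubspace_wandering[OF C]] .
  have EW: "E \<subseteq> dual.wandering C" using E by (auto simp: total_in_def)
  have EC: "E \<subseteq> C" using EW by (auto simp: ortho_minus_def)
  have CI: "C \<subseteq> isometric_part R" using C by (simp add: dual.invariant_isometric_def)
  let ?e = "\<lambda>(l::nat, e). (R ^^ l) e"
  have on: "orthonormal_family ?e (UNIV \<times> E)" by (rule dual.wold_orthonormal[OF C EW E(1)])
  have tot: "total_in ?e (UNIV \<times> E) C" by (rule dual.wold_total[OF C E(2)])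
  define g where "g = ortho_proj C h"
  have g: "g \<in> C" unfolding g_def by (rule ortho_proj_in[OF Cc])
  show ?thesis
  proof (rule LIMSEQ_I)
    fix r :: real assume r: "r > 0"
    let ?f = "\<lambda>i. cinner g (?e i) *\<^sub>C ?e i"
    have "\<forall>\<^sub>F H in finite_subsets_at_top (UNIV \<times> E). dist (sum ?f H) g < r"
      using fourier_expansion(1)[OF on tot Cc g] r unfolding has_sum_def by (rule tendstoD)
    then obtain H where H: "finite H" "H \<subseteq> UNIV \<times> E" "dist (sum ?f H) g < r"
      unfolding eventually_finite_subsets_at_top by blast
    define N where "N = Suc (Max (insert 0 (fst ` H)))"
    have HN: "fst i < N" if "i \<in> H" for i
      unfolding N_def less_Suc_eq_le using H(1) that by (intro Max_ge) auto
    have "norm (norm (ortho_proj C ((T ^^ k) h)) - 0) < r" if k: "k \<ge> N" for k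
    proof -
      define c where "c = ortho_proj C ((T ^^ k) h)"
      have c: "c \<in> C" unfolding c_def by (rule ortho_proj_in[OF Cc])
      have Rc: "(R ^^ k) c \<in> C" by (rule dual.invariant_isometric_T_pow[OF C c])
      \<comment> \<open>\<open>R\<^sup>k c\<close> is orthogonal to the first \<open>k\<close> translates of the wandering vectors.\<close>
      have "cinner (?f i) ((R ^^ k) c) = 0" if i: "i \<in> H" for i
      proof -
        obtain l e where le: "i = (l, e)" by (cases i)
        have e: "e \<in> E" and l: "l < k" using H(2) HN[OF i] i k le by auto
        have "(R ^^ k) c = (R ^^ l) ((R ^^ (k - l)) c)"
          using l by (simp flip: o_apply[of "R ^^ l"] funpow_add)
        hence "cinner ((R ^^ l) e) ((R ^^ k) c) = cinner e ((R ^^ (k - l)) c)"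
          using e EC CI by (simp add: dual.isometric_part_cinner subset_iff)
        also have "\<dots> = 0" using e EW l by (intro dual.wandering_orthogonal[OF C _ c]) auto
        finally show ?thesis by (simp add: le cinner_scaleC_left)
      qed
      hence 0: "cinner (sum ?f H) ((R ^^ k) c) = 0" by (simp add: cinner.sum_left)
      have "cinner c c = cinner ((T ^^ k) h) c"
        using cinner_ortho_proj_left[OF Cc c] by (simp add: c_def)
      also have "\<dots> = cinner h ((R ^^ k) c)" by (rule adj_pow)
      also have "\<dots> = cinner g ((R ^^ k) c)"
        unfolding g_def by (rule cinner_ortho_proj_left[OF Cc Rc, symmetric])
      also have "\<dots> = cinner (g - sum ?f H) ((R ^^ k) c)" by (simp add: cinner_diff_left 0)
      finally have eq: "complex_of_real ((norm c)\<^sup>2) = cinner (g - sum ?f H) ((R ^^ k) c)"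
        unfolding cinner_self .
      have "(norm c)\<^sup>2 = cmod (cinner (g - sum ?f H) ((R ^^ k) c))"
        unfolding eq[symmetric] by (simp add: norm_power)
      also have "\<dots> \<le> norm (g - sum ?f H) * norm ((R ^^ k) c)" by (rule cmod_cinner_le)
      also have "\<dots> \<le> norm (g - sum ?f H) * norm c"
        by (intro mult_left_mono dual.norm_T_pow_le) auto
      finally have "norm c \<le> norm (g - sum ?f H)"
        by (cases "norm c = 0") (auto simp: power2_eq_square)
      also have "\<dots> < r" using H(3) by (simp add: dist_norm norm_minus_commute)
      finally show ?thesis by (simp add: c_def)
    qed
    thus "\<exists>N. \<forall>k\<ge>N. norm (norm (ortho_proj C ((T ^^ k) h)) - 0) < r" by blast
  qed
qed

text \<open>Up to an error of norm at most \<open>\<parallel>P\<^sub>C T\<^sup>k h\<parallel>\<close>, which tends to \<open>0\<close>, the vector \<open>T\<^sup>k\<^sup>+\<^sup>n h\<close> is the image under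
  \<open>T\<^sup>n\<close> of a vector orthogonal to \<open>C\<close>, and so belongs to \<open>B\<close>.\<close>

lemma absorbingI:
  assumes B: "invariant_isometric B" and C: "cnu_adjoint_pair.invariant_isometric R C"
    and into: "\<And>x. (\<And>c. c \<in> C \<Longrightarrow> cinner x c = 0) \<Longrightarrow> (T ^^ n) x \<in> B"
  shows "absorbing B"
  unfolding absorbing_def
proof (intro conjI ballI B)
  interpret dual: cnu_adjoint_pair R T by (rule dual)
  have Bc: "closed_csubspace B" and Cc: "closed_csubspace C"
    using B C by (auto simp: invariant_isometric_def dual.invariant_isometric_def)
  fix h assume h: "h \<in> isometric_part T"
  let ?p = "\<lambda>k. norm (ortho_proj B ((T ^^ k) h))"
  have le: "?p k \<le> norm h" for k
    using norm_ortho_proj_le[OF Bc] norm_T_pow_le by (rule order_trans)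
  have ge: "norm h - norm (ortho_proj C ((T ^^ k) h)) \<le> ?p (k + n)" for k
  proof -
    let ?y = "(T ^^ k) h" and ?c = "ortho_proj C ((T ^^ k) h)"
    have kn: "(T ^^ (k + n)) h = (T ^^ n) ?y" by (simp only: add.commute[of k] funpow_add o_apply)
    have "(T ^^ n) (?y - ?c) \<in> B"
      by (rule into) (simp add: cinner_diff_left cinner_ortho_proj_left[OF Cc])
    hence "norm ((T ^^ n) ?y) - norm ((T ^^ n) ?y - (T ^^ n) (?y - ?c)) \<le> ?p (k + n)"
      unfolding kn by (rule norm_ortho_proj_ge[OF Bc])
    moreover have "(T ^^ n) ?y - (T ^^ n) (?y - ?c) = (T ^^ n) ?c"
      by (simp add: linear_simps(2)[OF bounded_linear_T_pow])
    moreover have "norm ((T ^^ n) ?y) = norm h"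
      unfolding kn[symmetric] by (rule isometric_part_norm[OF h])
    ultimately show ?thesis using norm_T_pow_le[of n ?c] by simp
  qed
  have "(\<lambda>k. norm h - norm (ortho_proj C ((T ^^ k) h))) \<longlonglongrightarrow> norm h - 0"
    by (intro tendsto_diff tendsto_const coshift_projection_tendsto_0[OF C])
  hence lower: "(\<lambda>k. norm h - norm (ortho_proj C ((T ^^ k) h))) \<longlonglongrightarrow> norm h" by simp
  have "(\<lambda>k. ?p (k + n)) \<longlonglongrightarrow> norm h"
    by (rule real_tendsto_sandwich[OF always_eventually always_eventually lower tendsto_const])
      (use ge le in blast)+
  thus "?p \<longlonglongrightarrow> norm h" by (rule LIMSEQ_offset)
qed

text \<open>The first space of the canonical representation. Its orthogonal complement consists of the \<open>y\<close> with
  \<open>D\<^sub>T\<^sub>* T\<^sup>*\<^sup>k y = 0\<close> for all \<open>k \<ge> n\<close>, that is with \<open>T\<^sup>*\<^sup>n y\<close> in the isometric part \<open>C\<close> of \<open>T\<^sup>*\<close>. Hence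
  \<open>T\<^sup>n\<close> maps the orthogonal complement of \<open>C\<close> into the space, as \<open>absorbingI\<close> demands.\<close>

lemma absorbing_closed_cspan:
  assumes defect: "\<And>k w. n \<le> k \<Longrightarrow> defect_op T ((T ^^ k) (defect_op R w)) = 0"
  shows "absorbing (closed_cspan {(T ^^ k) h | k h. n \<le> k \<and> h \<in> defect_space R})"
    (is "absorbing (closed_cspan ?X)")
proof -
  interpret dual: cnu_adjoint_pair R T by (rule dual)
  have RT: "cadjoint T = R" and TR: "cadjoint R = T" by (rule cadjoint_eqI, rule adj adj')+
  have DD: "defect_op T (defect_op T x) = x - R (T x)"
    and EE: "defect_op R (defect_op R x) = x - T (R x)" for x
    using defect_op_defect_op[OF contraction_T] defect_op_defect_op[OF contraction_R]
    by (simp_all add: RT TR)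
  have Dbl: "bounded_linear (defect_op T)"
    and Esa: "cinner (defect_op R x) y = cinner x (defect_op R y)"
    and Ebl: "bounded_linear (defect_op R)" for x y
    using positive_operator_defect_op[OF contraction_T] positive_operator_defect_op[OF contraction_R]
    by (auto simp: positive_operator_def intro: operator_on_bounded_linear positive_operator_selfadjoint)
  let ?B = "closed_cspan ?X"
  have Bc: "closed_csubspace ?B" by (rule closed_csubspace_closed_cspan)
  have tail: "R (T ((T ^^ k) h)) = (T ^^ k) h" if k: "n \<le> k" and h: "h \<in> defect_space R" for k h
  proof -
    have "range (defect_op R) \<subseteq> {h. defect_op T ((T ^^ k) h) = 0}" using defect[OF k] by auto
    moreover have "closed {h. defect_op T ((T ^^ k) h) = 0}"
      by (intro closed_Collect_eq linear_continuous_on continuous_on_const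
          bounded_linear_compose[OF Dbl] bounded_linear_T_pow)
    ultimately have "defect_op T ((T ^^ k) h) = 0"
      using h closure_minimal unfolding defect_space_def by blast
    hence "defect_op T (defect_op T ((T ^^ k) h)) = 0" by (simp add: linear_simps(3)[OF Dbl])
    thus ?thesis by (simp add: DD)
  qed
  have "?X \<subseteq> isometric_part T"
  proof safe
    fix k h assume "n \<le> k" "h \<in> defect_space R"
    hence "R (T ((T ^^ (j + k)) h)) = (T ^^ (j + k)) h" for j by (intro tail) auto
    thus "(T ^^ k) h \<in> isometric_part T" by (simp add: isometric_part_iff funpow_add)
  qed
  hence BI: "?B \<subseteq> isometric_part T"
    by (intro closed_cspan_minimal closed_csubspace_isometric_part)
  have "?X \<subseteq> T -` ?B"
  proof
    fix x assume "x \<in> ?X"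
    then obtain k h where x: "x = (T ^^ k) h" and "n \<le> k" "h \<in> defect_space R" by blast
    hence "(T ^^ Suc k) h \<in> ?X" using le_SucI by blast
    hence "(T ^^ Suc k) h \<in> ?B" by (rule subsetD[OF closed_cspan_superset])
    thus "x \<in> T -` ?B" unfolding funpow.simps o_apply x vimage_def by (rule CollectI)
  qed
  hence "?B \<subseteq> T -` ?B"
    using contraction_T by (intro closed_cspan_minimal closed_csubspace_vimage Bc)
      (simp_all add: contraction_def)
  hence Bi: "invariant_isometric ?B" using Bc BI by (auto simp: invariant_isometric_def)
  show ?thesis
  proof (rule absorbingI[OF Bi])
    show "dual.invariant_isometric (isometric_part R)"
      using dual.absorbing_isometric_part by (simp add: dual.absorbing_def)
    fix x assume x: "\<And>c. c \<in> isometric_part R \<Longrightarrow> cinner x c = 0"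
    show "(T ^^ n) x \<in> ?B"
    proof (rule closed_csubspace_memI[OF Bc])
      fix y assume y: "\<And>m. m \<in> ?B \<Longrightarrow> cinner m y = 0"
      have "T (R ((R ^^ k) ((R ^^ n) y))) = (R ^^ k) ((R ^^ n) y)" for k
      proof -
        have "defect_op R ((R ^^ (k + n)) y) = 0"
        proof (rule cinner_eqI)
          fix u
          have "defect_op R u \<in> defect_space R"
            unfolding defect_space_def by (rule subsetD[OF closure_subset rangeI])
          hence "(T ^^ (k + n)) (defect_op R u) \<in> ?X" using le_add2 by blast
          hence "cinner ((T ^^ (k + n)) (defect_op R u)) y = 0"
            by (intro y subsetD[OF closed_cspan_superset])
          hence "cinner u (defect_op R ((R ^^ (k + n)) y)) = 0" by (simp add: adj_pow Esa)
          thus "cinner (defect_op R ((R ^^ (k + n)) y)) u = cinner 0 u"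
            using cinner_commute[of _ u] by simp
        qed
        hence "defect_op R (defect_op R ((R ^^ (k + n)) y)) = 0"
          by (simp add: linear_simps(3)[OF Ebl])
        thus ?thesis by (simp add: EE funpow_add)
      qed
      hence "(R ^^ n) y \<in> isometric_part R" by (simp add: dual.isometric_part_iff)
      thus "cinner ((T ^^ n) x) y = 0" by (simp add: adj_pow x)
    qed
  qed
qed

text \<open>A vector orthogonal to the third space lies in \<open>K1 + K0\<close>, where \<open>T\<close> is triangular with a nilpotent
  corner: its \<open>n\<close>-th power maps \<open>K1 + K0\<close> into \<open>K1\<close>. The statement for \<open>T\<^sup>*\<close> follows by taking
  adjoints, with \<open>K1\<close> and \<open>Km\<close> exchanged.\<close>

lemma absorbing_triangular:
  assumes rep: "triangular_representation T n K1 K0 Km"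
  shows "absorbing K1" and "cnu_adjoint_pair.absorbing R Km"
proof -
  interpret T: bounded_linear T by (rule bounded_linear_T)
  interpret dual: cnu_adjoint_pair R T by (rule dual)
  have closed: "closed_csubspace K1" "closed_csubspace K0" "closed_csubspace Km"
    and orth: "\<And>a b. a \<in> K1 \<Longrightarrow> b \<in> K0 \<Longrightarrow> cinner a b = 0" "\<And>a c. a \<in> K1 \<Longrightarrow> c \<in> Km \<Longrightarrow> cinner a c = 0"
      "\<And>b c. b \<in> K0 \<Longrightarrow> c \<in> Km \<Longrightarrow> cinner b c = 0"
    and sum: "\<And>x. \<exists>a\<in>K1. \<exists>b\<in>K0. \<exists>c\<in>Km. x = a + b + c"
    and zero: "\<And>x. x \<in> K1 \<Longrightarrow> block K0 T x = 0" "\<And>x. x \<in> K1 \<Longrightarrow> block Km T x = 0"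
      "\<And>x. x \<in> K0 \<Longrightarrow> block Km T x = 0"
    and shift: "pure_shift K1 (block K1 T)"
    and nil: "nilpotent_of_order n K0 (block K0 T)"
    and coshift: "pure_coshift Km (block Km T)"
    using rep unfolding triangular_representation_def orthogonal_decomposition_def orthogonal_sets_def
    by auto
  have cs: "csubspace K1" "csubspace K0" "csubspace Km" using closed by (auto simp: closed_csubspace_def)
  have proj: "ortho_proj K1 (a + b + c) = a" "ortho_proj K0 (a + b + c) = b"
      "ortho_proj Km (a + b + c) = c" if "a \<in> K1" "b \<in> K0" "c \<in> Km" for a b c
  proof -
    have orth': "cinner b a = 0" "cinner c a = 0" "cinner c b = 0"
      if "a \<in> K1" "b \<in> K0" "c \<in> Km" for a b c
      using orth[of a] orth(3)[of b c] that cinner_commute[of b a] cinner_commute[of c a]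
        cinner_commute[of c b] by simp_all
    show "ortho_proj K1 (a + b + c) = a" "ortho_proj K0 (a + b + c) = b"
      "ortho_proj Km (a + b + c) = c"
      using that orth orth' by (auto intro!: ortho_projI cs simp: cinner_add_left)
  qed
  have split: "x = ortho_proj K1 x + ortho_proj K0 x + ortho_proj Km x" for x
  proof -
    obtain a b c where "a \<in> K1" "b \<in> K0" "c \<in> Km" "x = a + b + c" using sum by blast
    thus ?thesis using proj by simp
  qed
  have T1: "T x = block K1 T x" if "x \<in> K1" for x
    using split[of "T x"] zero(1,2)[OF that] by (simp add: block_def)
  have T0: "T x = block K1 T x + block K0 T x" if "x \<in> K0" for x
    using split[of "T x"] zero(3)[OF that] by (simp add: block_def)
  have in1: "block K1 T x \<in> K1" and in0: "block K0 T x \<in> K0" for x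
    using ortho_proj_in closed by (auto simp: block_def)
  have TK1: "T x \<in> K1" if "x \<in> K1" for x using T1[OF that] in1 by simp
  have TK1_pow: "(T ^^ k) x \<in> K1" if "x \<in> K1" for x k by (induction k) (auto simp: that TK1)
  have "norm (T x) = norm x" if "x \<in> K1" for x
    using shift that T1[OF that] by (simp add: pure_shift_def isometry_on_def)
  hence "K1 \<subseteq> isometric_part T" using TK1_pow by (auto simp: isometric_part_def)
  hence inv1: "invariant_isometric K1" using closed TK1 by (auto simp: invariant_isometric_def)
  have perp: "\<exists>a\<in>K1. \<exists>b\<in>K0. x = a + b" if x: "\<And>c. c \<in> Km \<Longrightarrow> cinner x c = 0" for x
  proof -
    have "ortho_proj Km x = 0" using x cs by (intro ortho_projI) (auto simp: csubspace_def)
    thus ?thesis using split[of x] ortho_proj_in closed by (metis add.right_neutral)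
  qed
  have into1: "(T ^^ n) x \<in> K1" if x: "\<And>c. c \<in> Km \<Longrightarrow> cinner x c = 0" for x
  proof -
    obtain a b where ab: "a \<in> K1" "b \<in> K0" "x = a + b" using perp[OF x] by auto
    have N: "(block K0 T ^^ k) b \<in> K0" for k by (induction k) (auto simp: ab in0)
    have "\<exists>d\<in>K1. (T ^^ k) b = d + (block K0 T ^^ k) b" for k
    proof (induction k)
      case 0
      thus ?case using cs by (auto simp: csubspace_def)
    next
      case (Suc k)
      then obtain d where d: "d \<in> K1" "(T ^^ k) b = d + (block K0 T ^^ k) b" by auto
      have "(T ^^ Suc k) b = (T d + block K1 T ((block K0 T ^^ k) b)) + (block K0 T ^^ Suc k) b"
        using T0[OF N[of k]] by (simp add: d T.add)
      moreover have "T d + block K1 T ((block K0 T ^^ k) b) \<in> K1"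
        using cs TK1[OF d(1)] in1 by (simp add: csubspace_def)
      ultimately show ?case by blast
    qed
    moreover have "(block K0 T ^^ n) b = 0" using nil ab by (simp add: nilpotent_of_order_def)
    ultimately have "(T ^^ n) b \<in> K1" by (metis add.right_neutral)
    thus ?thesis
      using TK1_pow[OF ab(1), of n] cs
      by (simp add: ab linear_simps(1)[OF bounded_linear_T_pow] csubspace_def)
  qed
  have RKm: "R y \<in> Km" if y: "y \<in> Km" for y
  proof (rule closed_csubspace_memI[OF closed(3)])
    fix x assume x: "\<And>m. m \<in> Km \<Longrightarrow> cinner m x = 0"
    have "cinner x c = 0" if "c \<in> Km" for c using x[OF that] cinner_commute[of x c] by simp
    then obtain a b where ab: "a \<in> K1" "b \<in> K0" "x = a + b" using perp by blast
    have "cinner (T a + (block K1 T b + block K0 T b)) y = 0"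
      using orth y TK1[OF ab(1)] in1 in0 by (simp add: cinner_add_left)
    hence "cinner (T x) y = 0" using T0[OF ab(2)] by (simp add: ab T.add)
    thus "cinner (R y) x = 0" using cinner_commute[of "R y" x] by (simp add: adj)
  qed
  have RKm_pow: "(R ^^ k) x \<in> Km" if "x \<in> Km" for x k by (induction k) (auto simp: that RKm)
  have "norm (R x) = norm x" if x: "x \<in> Km" for x
  proof -
    obtain V where V: "pure_shift Km V"
      "\<forall>x\<in>Km. \<forall>y\<in>Km. cinner (V x) y = cinner x (block Km T y)"
      using coshift by (auto simp: pure_coshift_def)
    have Vx: "V x \<in> Km" "norm (V x) = norm x"
      using V(1) x by (auto simp: pure_shift_def isometry_on_def operator_on_def)
    have "V x - R x \<in> Km" using Vx RKm[OF x] cs by (intro csubspace_diff)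
    hence "cinner (V x - R x) (V x - R x) = 0"
      using V(2) x by (simp add: cinner_diff_left adj' block_def cinner_ortho_proj_right[OF closed(3)])
    thus ?thesis using Vx by simp
  qed
  hence "Km \<subseteq> isometric_part R" using RKm_pow by (auto simp: isometric_part_def)
  hence invm: "dual.invariant_isometric Km" using closed RKm by (auto simp: dual.invariant_isometric_def)
  show "absorbing K1" by (rule absorbingI[OF inv1 invm into1])
  show "dual.absorbing Km"
  proof (rule dual.absorbingI[OF invm inv1])
    fix x assume x: "\<And>c. c \<in> K1 \<Longrightarrow> cinner x c = 0"
    show "(R ^^ n) x \<in> Km"
    proof (rule closed_csubspace_memI[OF closed(3)])
      fix y assume y: "\<And>m. m \<in> Km \<Longrightarrow> cinner m y = 0"
      have "cinner y c = 0" if "c \<in> Km" for c using y[OF that] cinner_commute[of y c] by simp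
      hence "(T ^^ n) y \<in> K1" by (rule into1)
      thus "cinner ((R ^^ n) x) y = 0" by (simp add: adj_pow' x)
    qed
  qed
qed

lemma block_invariant: "invariant_isometric A \<Longrightarrow> x \<in> A \<Longrightarrow> block A T x = T x"
  unfolding block_def invariant_isometric_def closed_csubspace_def by (intro ortho_proj_id) auto

lemma shifts_unitarily_equivalent:
  assumes sep: "separable_space (euclidean :: 'a topology)" and A: "absorbing A" and B: "absorbing B"
  shows "unitarily_equivalent A (block A T) B (block B T)"
proof -
  obtain U where U: "unitary_on A B U" "\<And>x. x \<in> A \<Longrightarrow> U (T x) = T (U x)"
    using absorbing_unitarily_equivalent[OF sep A B] by metis
  have "U x \<in> B" if "x \<in> A" for x using U(1) that by (auto simp: unitary_on_def)
  thus ?thesis using U A B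
    unfolding unitarily_equivalent_def absorbing_def by (auto simp: block_invariant)
qed

text \<open>The diagonal entry of \<open>T\<close> on a \<open>T\<^sup>*\<close>-invariant space is the adjoint of the restriction of \<open>T\<^sup>*\<close>, and a
  unitary that intertwines two operators also intertwines their adjoints.\<close>

lemma coshifts_unitarily_equivalent:
  assumes sep: "separable_space (euclidean :: 'a topology)"
    and A: "cnu_adjoint_pair.absorbing R A" and B: "cnu_adjoint_pair.absorbing R B"
  shows "unitarily_equivalent A (block A T) B (block B T)"
proof -
  interpret dual: cnu_adjoint_pair R T by (rule dual)
  obtain U where U: "unitary_on A B U" "\<And>x. x \<in> A \<Longrightarrow> U (R x) = R (U x)"
    using dual.absorbing_unitarily_equivalent[OF sep A B] by metis
  have Ac: "closed_csubspace A" "closed_csubspace B" and RA: "\<And>x. x \<in> A \<Longrightarrow> R x \<in> A"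
    using A B by (auto simp: dual.absorbing_def dual.invariant_isometric_def)
  hence As: "csubspace A" "csubspace B" by (auto simp: closed_csubspace_def)
  have img: "U ` A = B" using U(1) by (simp add: unitary_on_def)
  have "ortho_proj B (T (U x)) = U (ortho_proj A (T x))" if x: "x \<in> A" for x
  proof (rule ortho_projI[OF As(2)])
    have p: "ortho_proj A (T x) \<in> A" by (rule ortho_proj_in[OF Ac(1)])
    thus "U (ortho_proj A (T x)) \<in> B" using img by auto
    fix m assume "m \<in> B"
    then obtain a where a: "a \<in> A" "m = U a" using img by auto
    have "cinner (T (U x)) m = cinner (U x) (U (R a))" using a U(2) by (simp add: adj)
    also have "\<dots> = cinner (T x) a" using x RA[OF a(1)] by (simp add: unitary_on_cinner[OF U(1) As(1)] adj)
    also have "\<dots> = cinner (U (ortho_proj A (T x))) m"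
      using p a by (simp add: unitary_on_cinner[OF U(1) As(1)] cinner_ortho_proj_left[OF Ac(1)])
    finally show "cinner (T (U x) - U (ortho_proj A (T x))) m = 0" by (simp add: cinner_diff_left)
  qed
  thus ?thesis using U(1) unfolding unitarily_equivalent_def block_def by auto
qed

end

lemma cnu_adjoint_pair_cadjoint:
  fixes T :: "'a::complex_hilbert \<Rightarrow> 'a"
  assumes T: "contraction T" and cnu: "completely_nonunitary UNIV T"
  shows "cnu_adjoint_pair T (cadjoint T)"
proof
  have op: "operator_on UNIV UNIV T" using T by (simp add: contraction_def)
  show adj: "cinner (T x) y = cinner x (cadjoint T y)" for x y by (rule cinner_cadjoint[OF op])
  fix M assume M: "closed_csubspace M"
    and inv: "\<And>x. x \<in> M \<Longrightarrow> T x \<in> M \<and> cadjoint T x \<in> M \<and> cadjoint T (T x) = x \<and> T (cadjoint T x) = x"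
  have "reducing UNIV T M"
    using M inv unfolding reducing_def ortho_minus_def by (auto simp: adj)
  moreover have "unitary_on M M T"
    unfolding unitary_on_def isometry_on_def
  proof (intro conjI ballI equalityI subsetI)
    show "operator_on M M T" using op inv unfolding operator_on_def by auto
    fix x assume x: "x \<in> M"
    have "cinner (T x) (T x) = cinner x x" using inv[OF x] by (simp add: adj)
    hence "(norm (T x))\<^sup>2 = (norm x)\<^sup>2" unfolding cinner_self of_real_eq_iff .
    thus "norm (T x) = norm x" by simp
    show "x \<in> T ` M" using inv[OF x] by (metis image_eqI)
  qed (use inv in auto)
  ultimately show "M = {0}" using cnu by (auto simp: completely_nonunitary_def)
qed (use T contraction_cadjoint in auto)

section \<open>Unitary equivalence of the shifts and of the co-shifts\<close>

theorem theorem4p1: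
  fixes T :: "'a::complex_hilbert \<Rightarrow> 'a"
    and n :: nat
    and H1 H0 Hm H1s H0s Hms H1' H0' Hm' :: "'a set"
  assumes "separable_space (euclidean :: 'a topology)"
    and "contraction T"
    and "completely_nonunitary UNIV T"
    and "char_fun_polynomial T n"
    and "canonical_spaces T n = (H1, H0, Hm)"
    and "star_canonical_spaces T n = (H1s, H0s, Hms)"
    and "triangular_representation T n H1' H0' Hm'"
  shows "unitarily_equivalent H1 (block H1 T) H1' (block H1' T) \<and>
         unitarily_equivalent H1' (block H1' T) H1s (block H1s T) \<and>
         unitarily_equivalent H1 (block H1 T) H1s (block H1s T) \<and>
         unitarily_equivalent Hm (block Hm T) Hm' (block Hm' T) \<and>
         unitarily_equivalent Hm' (block Hm' T) Hms (block Hms T) \<and>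
         unitarily_equivalent Hm (block Hm T) Hms (block Hms T)"
proof -
  note sep = assms(1)
  interpret fwd: cnu_adjoint_pair T "cadjoint T"
    by (rule cnu_adjoint_pair_cadjoint[OF assms(2,3)])
  interpret bwd: cnu_adjoint_pair "cadjoint T" T by (rule fwd.dual)
  have "H1 = closed_cspan {(T ^^ k) h | k h. n \<le> k \<and> h \<in> defect_space (cadjoint T)}"
    using assms(5) by (simp add: canonical_spaces_def Let_def)
  hence H1: "fwd.absorbing H1"
    by (simp only:) (rule fwd.absorbing_closed_cspan, rule char_fun_polynomial_defect(1)[OF assms(2,4)])
  have "Hms = closed_cspan {(cadjoint T ^^ k) h | k h. n \<le> k \<and> h \<in> defect_space T}"
    using assms(6) by (simp add: star_canonical_spaces_def Let_def)
  hence Hms: "bwd.absorbing Hms"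
    by (simp only:) (rule bwd.absorbing_closed_cspan, rule char_fun_polynomial_defect(2)[OF assms(2,4)])
  have H1s: "fwd.absorbing H1s"
    using fwd.absorbing_isometric_part assms(6)
    by (simp add: star_canonical_spaces_def Let_def isometric_part_def)
  have Hm: "bwd.absorbing Hm"
    using bwd.absorbing_isometric_part assms(5)
    by (simp add: canonical_spaces_def Let_def isometric_part_def)
  note H1' = fwd.absorbing_triangular(1)[OF assms(7)]
    and Hm' = fwd.absorbing_triangular(2)[OF assms(7)]
  show ?thesis
    by (intro conjI fwd.shifts_unitarily_equivalent fwd.coshifts_unitarily_equivalent
        sep H1 H1' H1s Hm Hm' Hms)
qed

end
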